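(* Let $f:[0,1]\to[0,1]$ be a measurable function. The following are equivalent: (i) there exists a tournament limit $\Gamma$ whose outdegree distribution $\nu^+(\Gamma)$ is the law of $f(U)$, where $U\sim U[0,1]$; (ii) there exists a tournament kernel $W$ with score function $f$, i.e. $\int_0^1W(x,y)\,dy=f(x)$ for all $x\in[0,1]$; (iii) $f$ satisfies condition I: for every measurable $B\subseteq[0,1]$, $\int_Bf(x)\,dx\ge \mu(B)^2/2$, with equality when $\mu(B)=1$ ($\mu$ = Lebesgue measure).
   Context: A digraph $F$ has a finite vertex set $V(F)$ and an edge set $E(F)\subseteq\{(u,v)\in V(F)^2: u\neq v\}$. A tournament is a digraph in which for every pair of distinct vertices $u,v$ exactly one of $(u,v),(v,u)$ is an edge. For digraphs $F,G$ let $t(F,G)=\hom(F,G)/|V(G)|^{|V(F)|}$, where $\hom(F,G)$ is the number of maps $\phi:V(F)\to V(G)$ with $(\phi(i),\phi(j))\in E(G)$ whenever $(i,j)\in E(F)$. A sequence of tournaments $(G_n)$ with $|V(G_n)|\to\infty$ is convergent if $t(F,G_n)$ converges for every digraph $F$; a tournament limit $\Gamma$ is the family of numbers $t(F,\Gamma):=\lim_n t(F,G_n)$ of some convergent sequence. A tournament kernel is a measurable $W:[0,1]^2\to[0,1]$ with $W(x,y)+W(y,x)=1$ for a.e. $(x,y)$; $t(F,W)=\int_{[0,1]^{V(F)}}\prod_{(i,j)\in E(F)}W(x_i,x_j)\prod_i dx_i$, and $W$ represents $\Gamma$ if $t(F,W)=t(F,\Gamma)$ for all $F$. For $m,n\ge0$,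 $\mathsf{S}_{m,n}$ is the digraph on disjoint sets $A_1\cup A_2\cup A_3$ with $|A_1|=m,|A_2|=1,|A_3|=n$ and edges $(u,v)$ for $u\in A_i,v\in A_j,i<j$. The degree distribution $\nu(\Gamma)$ is the unique probability distribution on $[0,1]^2$ with $\int x^my^n\,d\nu(\Gamma)=t(\mathsf{S}_{m,n},\Gamma)$ for all $m,n\ge0$; its second marginal $\nu^+(\Gamma)$ is the outdegree distribution (the first marginal $\nu^-(\Gamma)$ is the indegree distribution).
   Formalization: In S_{m,n} the edges go only from A_1 to A_2 and from A_2 to A_3; the edges from A_1 to A_3 are dropped, since with them ν(Γ) need not exist and the equivalence fails for f = 1/2 (the (1,1) moment would have to be 1/4, but t(S_{1,1},Γ) = 1/8). *)

theory Defs
  imports "HOL-Probability.Probability" "Graph_Theory.Pair_Digraph"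
begin

definition tournament :: "'a pair_pre_digraph \<Rightarrow> bool" where
  "tournament G \<longleftrightarrow> pair_digraph G \<and>
     (\<forall>u\<in>pverts G. \<forall>v\<in>pverts G. u \<noteq> v \<longrightarrow> ((u, v) \<in> parcs G) \<noteq> ((v, u) \<in> parcs G))"

text \<open>Maps between vertex sets are taken extensional, so that each is counted once.\<close>

definition digraph_homs :: "'a pair_pre_digraph \<Rightarrow> 'b pair_pre_digraph \<Rightarrow> ('a \<Rightarrow> 'b) set" where
  "digraph_homs F G =
     {\<phi> \<in> pverts F \<rightarrow>\<^sub>E pverts G. \<forall>(i, j)\<in>parcs F. (\<phi> i, \<phi> j) \<in> parcs G}"

definition hom_density :: "'a pair_pre_digraph \<Rightarrow> 'b pair_pre_digraph \<Rightarrow> real" where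
  "hom_density F G =
     real (card (digraph_homs F G)) / real (card (pverts G)) ^ card (pverts F)"

text \<open>
  A tournament limit is a family of reals indexed by the finite digraphs. Homomorphism
  densities are invariant under isomorphism and every finite digraph has a copy on
  natural-number vertices, so only digraphs on subsets of \<^typ>\<open>nat\<close> are used as indices and
  as members of sequences. Values of the family at arguments that are not digraphs are
  irrelevant.
\<close>

definition tournament_limit :: "(nat pair_pre_digraph \<Rightarrow> real) \<Rightarrow> bool" where
  "tournament_limit \<Gamma> \<longleftrightarrow>
     (\<exists>G :: nat \<Rightarrow> nat pair_pre_digraph.
        (\<forall>n. tournament (G n)) \<and>
        filterlim (\<lambda>n. card (pverts (G n))) at_top sequentially \<and>
        (\<forall>F. pair_digraph F \<longrightarrow> (\<lambda>n. hom_density F (G n)) \<longlonglongrightarrow> \<Gamma> F))"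

text \<open>
  The digraph with layers \<open>A\<^sub>1 = {..<m}\<close>, \<open>A\<^sub>2 = {m}\<close>, \<open>A\<^sub>3 = {m<..m + n}\<close> and all edges from
  each layer to the next one: its density is the joint moment of order \<open>(m, n)\<close> of the
  indegree and outdegree of the vertex in the middle layer. There are deliberately no edges
  from \<open>A\<^sub>1\<close> to \<open>A\<^sub>3\<close>. With them the densities would in general not be the moments of any
  measure: for the constant kernel \<open>1/2\<close> they would equal \<open>(1/2) ^ (m + n + m * n)\<close>, whose
  marginal moments force the point mass at \<open>(1/2, 1/2)\<close>, which has mixed moments
  \<open>(1/2) ^ (m + n)\<close>. The digraphs with \<open>m = 0\<close> or \<open>n = 0\<close>, which determine
  the two marginals, are the same under either convention.
\<close>

definition S_digraph :: "nat \<Rightarrow> nat \<Rightarrow> nat pair_pre_digraph" where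
  "S_digraph m n =
     \<lparr>pverts = {..m + n}, parcs = ({..<m} \<times> {m}) \<union> ({m} \<times> {m<..m + n})\<rparr>"

definition degree_distribution ::
    "(nat pair_pre_digraph \<Rightarrow> real) \<Rightarrow> (real \<times> real) measure \<Rightarrow> bool" where
  "degree_distribution \<Gamma> \<nu> \<longleftrightarrow>
     prob_space \<nu> \<and> sets \<nu> = sets borel \<and> (AE p in \<nu>. p \<in> {0..1} \<times> {0..1}) \<and>
     (\<forall>m n. (\<integral>(x, y). x ^ m * y ^ n \<partial>\<nu>) = \<Gamma> (S_digraph m n))"

definition outdegree_distribution ::
    "(nat pair_pre_digraph \<Rightarrow> real) \<Rightarrow> real measure \<Rightarrow> bool" where
  "outdegree_distribution \<Gamma> \<rho> \<longleftrightarrow>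
     (\<exists>\<nu>. degree_distribution \<Gamma> \<nu> \<and> \<rho> = distr \<nu> borel snd)"

text \<open>Measurability is throughout with respect to the Lebesgue sigma-algebras.\<close>

definition tournament_kernel :: "(real \<Rightarrow> real \<Rightarrow> real) \<Rightarrow> bool" where
  "tournament_kernel W \<longleftrightarrow>
     (\<lambda>(x, y). W x y) \<in> borel_measurable (lebesgue_on ({0..1} \<times> {0..1})) \<and>
     (\<forall>x\<in>{0..1}. \<forall>y\<in>{0..1}. W x y \<in> {0..1}) \<and>
     (AE (x, y) in lebesgue_on ({0..1} \<times> {0..1}). W x y + W y x = 1)"

text \<open>
  The section \<open>W x\<close> is required to be integrable for every \<open>x\<close> (Lebesgue measurability of
  \<open>W\<close> on the square alone only gives this for almost every \<open>x\<close>).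
\<close>

definition has_score_function :: "(real \<Rightarrow> real \<Rightarrow> real) \<Rightarrow> (real \<Rightarrow> real) \<Rightarrow> bool" where
  "has_score_function W f \<longleftrightarrow>
     (\<forall>x\<in>{0..1}. has_bochner_integral (lebesgue_on {0..1}) (W x) (f x))"

definition condition_I :: "(real \<Rightarrow> real) \<Rightarrow> bool" where
  "condition_I f \<longleftrightarrow>
     (\<forall>B\<in>sets lebesgue. B \<subseteq> {0..1} \<longrightarrow>
        (LINT x:B|lebesgue. f x) \<ge> (measure lebesgue B)\<^sup>2 / 2 \<and>
        (measure lebesgue B = 1 \<longrightarrow> (LINT x:B|lebesgue. f x) = (measure lebesgue B)\<^sup>2 / 2))"

end

(*
  Condition I says that f(U) precedes U in the convex order: E (c - f(U))^+ <= c^2/2 for all c, and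
  E f(U) = 1/2.  Everything rests on one layer-cake inequality: under this condition
  int g f >= 1/2 int int min (g x) (g y) for every bounded g.

  Condition I ==> kernel: let g = f - s_W be the defect of the score s_W of a kernel W.  Moving W
  towards the kernel V(x,y) = [g x > g y] + [g x = g y]/2 decreases ||f - s_W||, since
  int g s_V = 1/2 int int max (g x) (g y) >= int g f.  Hence the infimum of ||f - s_W|| is 0.  To
  attain it without weak compactness, choose kernels W_n of almost minimal L^2 norm among those with
  ||f - s_W||^2 <= 1/n; these sets are convex and nested, so the parallelogram law makes (W_n) Cauchy.

  Condition I ==> limit: take quantiles a_v of the law of f(U) and a tournament on N vertices
  minimising the sum of (d_v/N - a_v)^2.  Reversing an arc does not improve it, which combined with
  the same layer-cake inequality bounds the mean squared deviation by 4/N.  A diagonal subsequence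
  converges; as indegree + outdegree = N - 1, its degree distribution is the law of (1 - f(U), f(U)).

  Conversely, a kernel yields condition I by symmetrising over B x B.  For a limit, the scores of
  a finite tournament satisfy the convex order inequality up to O(1/N), and this passes to the limit
  because moments determine the expectations of continuous functions on [0,1].
*)
theory Submission
  imports Defs "HOL-Library.Diagonal_Subsequence" "HOL-Real_Asymp.Real_Asymp"
begin

section \<open>A layer-cake inequality\<close>

text \<open>The three statements never meet directly: each is shown equivalent to
  \<open>landau_condition\<close> for one Borel function \<open>f'\<close> that agrees with
  \<open>f\<close> almost everywhere. This is a continuous form of Landau's theorem on score
  sequences. Sufficiency is a conditional gradient argument. The kernel V that orders points by g
  maximises the linear functional int g s_V over the convex set of kernels, and the layer-cake
  inequality, applied to -g, says that this maximum is at least int g f: no direction g separates f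
  from the attainable scores. The same inequality drives the finite problem, so it is stated on an
  arbitrary probability space with a slack \<eta>, which is 0 for kernels and 1/N for N vertices.
  Mass on subsets does not survive approximation, as indicators are discontinuous. The hinge form E
  (c - f)^+ \<le> c^2/2 involves only 1-Lipschitz functions, hence the comparison with finite
  tournaments uses it. A last obstacle is pointwise: the score has to be f x at every x, while the
  construction gives it almost everywhere. Since skewness is required only almost everywhere, the
  exceptional rows can be overwritten.\<close>

context prob_space
begin

text \<open>Slice by levels: \<open>g x + 1\<close> is the length of the set of levels
  \<open>t\<close> in [-1,1] below \<open>g x\<close>, so the integral of \<open>g * f\<close> is
  the integral over \<open>t\<close> of the mass of \<open>f\<close> on \<open>{g > t}\<close>,
  minus the total mass of \<open>f\<close>. With \<open>b t\<close> the measure of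
  \<open>{g > t}\<close>, \<open>lower\<close> bounds each slice below by
  \<open>(b t)^2 / 2 - \<eta>\<close>, and \<open>(b t)^2\<close> integrates to the double integral
  of \<open>min (g x) (g y)\<close> plus 1. The slack enters twice through the length of [-1,1] and
  once through \<open>total\<close>.\<close>

lemma layer_cake_min:
  fixes f g :: "'a \<Rightarrow> real"
  assumes f[measurable]: "f \<in> borel_measurable M" and f01: "\<And>x. x \<in> space M \<Longrightarrow> f x \<in> {0..1}"
    and g[measurable]: "g \<in> borel_measurable M" and g1: "\<And>x. x \<in> space M \<Longrightarrow> \<bar>g x\<bar> \<le> 1"
    and lower: "\<And>B. B \<in> sets M \<Longrightarrow> (prob B)\<^sup>2 / 2 - \<eta> \<le> (\<integral>x. indicator B x * f x \<partial>M)"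
    and total: "(\<integral>x. f x \<partial>M) \<le> 1 / 2 + \<eta>"
  shows "(\<integral>x. (\<integral>y. min (g x) (g y) \<partial>M) \<partial>M) / 2 - 3 * \<eta> \<le> (\<integral>x. g x * f x \<partial>M)"
proof -
  define N where "N = density lborel (indicator {-1..1::real})"
  have [measurable_cong, simp]: "sets N = sets borel" "space N = UNIV"
    by (simp_all add: N_def)
  interpret N: finite_measure N
    by (rule finite_measureI) (simp add: N_def emeasure_density)
  interpret P: pair_sigma_finite M N ..
  interpret PN: finite_measure "M \<Otimes>\<^sub>M N"
    by (rule finite_measure_pair_measure) unfold_locales
  have N_univ: "measure N UNIV = 2"
    by (simp add: N_def measure_def emeasure_density)
  define s :: "'a \<Rightarrow> real \<Rightarrow> real" where "s x t = (if t < g x then 1 else 0)" for x t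
  have s_meas[measurable]: "(\<lambda>(x, t). s x t) \<in> borel_measurable (M \<Otimes>\<^sub>M N)"
    unfolding s_def by measurable
  have s_meas'[measurable]: "(\<lambda>x. s x t) \<in> borel_measurable M" for t
    unfolding s_def by measurable
  have s_meas''[measurable]: "(\<lambda>t. s x t) \<in> borel_measurable borel" for x
    unfolding s_def by measurable
  have s01: "0 \<le> s x t" "s x t \<le> 1" for x t by (auto simp: s_def)
  define b where "b t = (\<integral>x. s x t \<partial>M)" for t
  have b_meas[measurable]: "b \<in> borel_measurable borel"
    unfolding b_def s_def by measurable
  have b_eq: "b t = prob {x \<in> space M. t < g x}" for t
  proof -
    have "b t = (\<integral>x. indicator {x \<in> space M. t < g x} x \<partial>M)"
      unfolding b_def s_def by (intro Bochner_Integration.integral_cong) (auto simp: indicator_def)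
    then show ?thesis by simp
  qed
  have b01: "0 \<le> b t" "b t \<le> 1" for t by (auto simp: b_eq)
  have len: "(\<integral>t. (if t < a then 1 else 0) \<partial>N) = a + 1" if "\<bar>a\<bar> \<le> 1" for a :: real
  proof -
    have "(\<integral>t. (if t < a then 1 else 0) \<partial>N) = (\<integral>t. indicator {..<a} t \<partial>N)"
      by (intro Bochner_Integration.integral_cong) (auto simp: indicator_def)
    also have "\<dots> = measure N {..<a}" by simp
    also have "measure N {..<a} = a + 1"
    proof -
      have "emeasure N {..<a} = (\<integral>\<^sup>+t. indicator {-1..1} t * indicator {..<a} t \<partial>lborel)"
        unfolding N_def by (rule emeasure_density) auto
      also have "\<dots> = (\<integral>\<^sup>+t. indicator {-1..<a} t \<partial>lborel)"
        by (intro nn_integral_cong) (use that in \<open>auto split: split_indicator\<close>)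
      also have "\<dots> = emeasure lborel {-1..<a}" by simp
      finally have "emeasure N {..<a} = emeasure lborel {-1..<a}" .
      then show ?thesis using that by (simp add: measure_def)
    qed
    finally show ?thesis .
  qed
  have g_eq: "g x = (\<integral>t. s x t \<partial>N) - 1" if "x \<in> space M" for x
    unfolding s_def using len g1 that by simp
  have fi: "integrable M f"
    by (rule integrable_const_bound[where B = 1]) (use f01 in auto)
  have si: "integrable M (\<lambda>x. f x * s x t)" for t
    by (rule integrable_const_bound[where B = 1])
      (use f01 s01 in \<open>auto intro!: AE_I2 mult_le_one simp: abs_mult\<close>)
  have gfi: "integrable M (\<lambda>x. f x * (g x + 1))"
  proof (rule integrable_const_bound[where B = 2])
    have "norm (f x * (g x + 1)) \<le> 1 * 2" if "x \<in> space M" for x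
      using f01[OF that] g1[OF that] unfolding real_norm_def abs_mult by (intro mult_mono) auto
    then show "AE x in M. norm (f x * (g x + 1)) \<le> 2" by (intro AE_I2) simp
  qed measurable
  have int_pair: "integrable (M \<Otimes>\<^sub>M N) (\<lambda>(x, t). h x t)"
    if "(\<lambda>(x, t). h x t) \<in> borel_measurable (M \<Otimes>\<^sub>M N)"
      and "\<And>x t. x \<in> space M \<Longrightarrow> 0 \<le> h x t" "\<And>x t. x \<in> space M \<Longrightarrow> h x t \<le> (1::real)" for h
    by (rule PN.integrable_const_bound[where B = 1])
      (use that in \<open>auto intro!: AE_I2 simp: space_pair_measure\<close>)
  have b2i: "integrable N (\<lambda>t. (b t)\<^sup>2)"
    by (rule N.integrable_const_bound[where B = 1]) (use b01 in \<open>auto intro!: AE_I2 simp: power_le_one\<close>)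
  have "(\<integral>x. g x * f x \<partial>M) = (\<integral>x. f x * (g x + 1) - f x \<partial>M)"
    by (simp add: algebra_simps)
  also have "\<dots> = (\<integral>x. f x * (g x + 1) \<partial>M) - (\<integral>x. f x \<partial>M)"
    by (intro Bochner_Integration.integral_diff gfi fi)
  finally have 1: "(\<integral>x. g x * f x \<partial>M) = (\<integral>x. f x * (g x + 1) \<partial>M) - (\<integral>x. f x \<partial>M)" .
  have "(\<integral>t. (b t)\<^sup>2 / 2 - \<eta> \<partial>N) \<le> (\<integral>t. (\<integral>x. f x * s x t \<partial>M) \<partial>N)"
  proof (intro integral_mono N.integrable_const_bound[where B = "1 + \<bar>\<eta>\<bar>"] AE_I2)
    fix t
    have "(\<integral>x. indicator {x \<in> space M. t < g x} x * f x \<partial>M) = (\<integral>x. f x * s x t \<partial>M)"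
      by (intro Bochner_Integration.integral_cong) (auto simp: s_def)
    then show "(b t)\<^sup>2 / 2 - \<eta> \<le> (\<integral>x. f x * s x t \<partial>M)"
      using lower[of "{x \<in> space M. t < g x}"] by (simp add: b_eq)
    have "(b t)\<^sup>2 \<le> 1" using b01[of t] by (simp add: power_le_one)
    moreover have "0 \<le> (b t)\<^sup>2" by simp
    ultimately show "norm ((b t)\<^sup>2 / 2 - \<eta>) \<le> 1 + \<bar>\<eta>\<bar>"
      unfolding real_norm_def by linarith
    have "(\<integral>x. f x * s x t \<partial>M) \<le> (\<integral>x. 1 \<partial>M)"
      by (intro integral_mono si) (use f01 s01 in \<open>auto intro!: mult_le_one\<close>)
    moreover have "0 \<le> (\<integral>x. f x * s x t \<partial>M)"
      by (intro Bochner_Integration.integral_nonneg) (use f01 s01 in auto)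
    ultimately show "norm (\<integral>x. f x * s x t \<partial>M) \<le> 1 + \<bar>\<eta>\<bar>" by (simp add: prob_space)
  qed measurable
  also have "\<dots> = (\<integral>x. (\<integral>t. f x * s x t \<partial>N) \<partial>M)"
    by (rule P.Fubini_integral) (rule int_pair, use f01 s01 in
      \<open>auto intro!: mult_le_one simp: abs_mult space_pair_measure\<close>)
  also have "\<dots> = (\<integral>x. f x * (g x + 1) \<partial>M)"
    by (intro Bochner_Integration.integral_cong) (simp_all add: g_eq)
  also have "(\<integral>t. (b t)\<^sup>2 / 2 - \<eta> \<partial>N) = (\<integral>t. (b t)\<^sup>2 \<partial>N) / 2 - 2 * \<eta>"
    by (subst Bochner_Integration.integral_diff) (simp_all add: N_univ b2i)
  finally have *: "(\<integral>t. (b t)\<^sup>2 \<partial>N) / 2 - 3 * \<eta> - 1 / 2 \<le> (\<integral>x. g x * f x \<partial>M)"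
    using total 1 by linarith
  \<comment> \<open>A level is below both \<open>g x\<close> and \<open>g y\<close> iff it is below
    their minimum, so the minimum is the length of a product of two step functions, shifted by 1;
    averaging over \<open>y\<close> turns the second factor into \<open>b\<close>.\<close>
  have inner: "(\<integral>y. min (g x) (g y) \<partial>M) = (\<integral>t. s x t * b t \<partial>N) - 1" if x: "x \<in> space M" for x
  proof -
    have "(\<integral>y. min (g x) (g y) \<partial>M) = (\<integral>y. (\<integral>t. s x t * s y t \<partial>N) - 1 \<partial>M)"
    proof (intro Bochner_Integration.integral_cong refl)
      fix y assume y: "y \<in> space M"
      have "(\<integral>t. s x t * s y t \<partial>N) = (\<integral>t. (if t < min (g x) (g y) then 1 else 0) \<partial>N)"
        by (intro Bochner_Integration.integral_cong) (auto simp: s_def)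
      also have "\<dots> = min (g x) (g y) + 1"
        by (rule len) (use g1[OF x] g1[OF y] in \<open>auto simp: min_def\<close>)
      finally show "min (g x) (g y) = (\<integral>t. s x t * s y t \<partial>N) - 1" by simp
    qed
    also have "\<dots> = (\<integral>y. (\<integral>t. s x t * s y t \<partial>N) \<partial>M) - 1"
    proof (subst Bochner_Integration.integral_diff)
      have "integrable (M \<Otimes>\<^sub>M N) (\<lambda>(y, t). s x t * s y t)"
        by (rule int_pair) (use s01 in \<open>auto intro!: mult_le_one\<close>)
      then show "integrable M (\<lambda>y. \<integral>t. s x t * s y t \<partial>N)" by (rule P.integrable_fst)
    qed (simp_all add: prob_space)
    also have "(\<integral>y. (\<integral>t. s x t * s y t \<partial>N) \<partial>M) = (\<integral>t. (\<integral>y. s x t * s y t \<partial>M) \<partial>N)"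
      by (rule P.Fubini_integral[symmetric], rule int_pair) (use s01 in \<open>auto intro!: mult_le_one\<close>)
    finally show ?thesis by (simp add: b_def)
  qed
  have "(\<integral>x. (\<integral>y. min (g x) (g y) \<partial>M) \<partial>M) = (\<integral>x. (\<integral>t. s x t * b t \<partial>N) - 1 \<partial>M)"
    by (intro Bochner_Integration.integral_cong refl inner)
  also have "\<dots> = (\<integral>x. (\<integral>t. s x t * b t \<partial>N) \<partial>M) - 1"
  proof (subst Bochner_Integration.integral_diff)
    have "integrable (M \<Otimes>\<^sub>M N) (\<lambda>(x, t). s x t * b t)"
      by (rule int_pair) (use s01 b01 in \<open>auto intro!: mult_le_one\<close>)
    then show "integrable M (\<lambda>x. \<integral>t. s x t * b t \<partial>N)" by (rule P.integrable_fst)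
  qed (simp_all add: prob_space)
  also have "(\<integral>x. (\<integral>t. s x t * b t \<partial>N) \<partial>M) = (\<integral>t. (\<integral>x. s x t * b t \<partial>M) \<partial>N)"
    by (rule P.Fubini_integral[symmetric], rule int_pair) (use s01 b01 in \<open>auto intro!: mult_le_one\<close>)
  also have "\<dots> = (\<integral>t. (b t)\<^sup>2 \<partial>N)"
    by (simp add: b_def power2_eq_square)
  finally show ?thesis using * by (simp add: diff_divide_distrib)
qed

end

section \<open>Kernels with prescribed score function\<close>

text \<open>Skewness holds at every pair of points, not just almost everywhere, so that swapping
  coordinates, convex combinations and pointwise limits need no null sets. On the diagonal it forces
  the value 1/2.\<close>

definition skew_kernels :: "'a measure \<Rightarrow> ('a \<times> 'a \<Rightarrow> real) set" where
  "skew_kernels M = {W \<in> borel_measurable (M \<Otimes>\<^sub>M M).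
     \<forall>x\<in>space M. \<forall>y\<in>space M. W (x, y) \<in> {0..1} \<and> W (x, y) + W (y, x) = 1}"

definition score :: "'a measure \<Rightarrow> ('a \<times> 'a \<Rightarrow> real) \<Rightarrow> 'a \<Rightarrow> real" where
  "score M W x = (\<integral>y. W (x, y) \<partial>M)"

definition score_error :: "'a measure \<Rightarrow> ('a \<Rightarrow> real) \<Rightarrow> ('a \<times> 'a \<Rightarrow> real) \<Rightarrow> real" where
  "score_error M f W = (\<integral>x. (score M W x - f x)\<^sup>2 \<partial>M)"

lemma skew_kernelsD:
  assumes "W \<in> skew_kernels M"
  shows "W \<in> borel_measurable (M \<Otimes>\<^sub>M M)"
    and "\<And>x y. x \<in> space M \<Longrightarrow> y \<in> space M \<Longrightarrow> 0 \<le> W (x, y)"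
    and "\<And>x y. x \<in> space M \<Longrightarrow> y \<in> space M \<Longrightarrow> W (x, y) \<le> 1"
    and "\<And>x y. x \<in> space M \<Longrightarrow> y \<in> space M \<Longrightarrow> W (x, y) + W (y, x) = 1"
  using assms by (auto simp: skew_kernels_def)

lemma skew_kernels_convex:
  assumes W: "W \<in> skew_kernels M" and V: "V \<in> skew_kernels M" and t: "t \<in> {0..1}"
  shows "(\<lambda>p. (1 - t) * W p + t * V p) \<in> skew_kernels M"
proof -
  note [measurable] = skew_kernelsD(1)[OF W] skew_kernelsD(1)[OF V]
  have "(1 - t) * W (x, y) + t * V (x, y) \<in> {0..1}
      \<and> (1 - t) * W (x, y) + t * V (x, y) + ((1 - t) * W (y, x) + t * V (y, x)) = 1"
    if "x \<in> space M" "y \<in> space M" for x y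
  proof -
    have "(1 - t) * W (x, y) + t * V (x, y) \<le> (1 - t) * 1 + t * 1"
      using t skew_kernelsD(3)[OF W that] skew_kernelsD(3)[OF V that]
      by (intro add_mono mult_left_mono) auto
    moreover have "0 \<le> (1 - t) * W (x, y) + t * V (x, y)"
      using t skew_kernelsD(2)[OF W that] skew_kernelsD(2)[OF V that] by auto
    moreover have "(1 - t) * W (x, y) + t * V (x, y) + ((1 - t) * W (y, x) + t * V (y, x))
        = (1 - t) * (W (x, y) + W (y, x)) + t * (V (x, y) + V (y, x))"
      by (simp add: algebra_simps)
    ultimately show ?thesis
      using skew_kernelsD(4)[OF W that] skew_kernelsD(4)[OF V that] by simp
  qed
  then show ?thesis unfolding skew_kernels_def by simp
qed

context prob_space
begin

lemma integrable_bounded_real: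
  fixes h :: "'a \<Rightarrow> real"
  assumes "h \<in> borel_measurable M" "\<And>x. x \<in> space M \<Longrightarrow> \<bar>h x\<bar> \<le> c"
  shows "integrable M h"
  by (rule integrable_const_bound[where B = c]) (use assms in auto)

lemma score_measurable: "W \<in> skew_kernels M \<Longrightarrow> score M W \<in> borel_measurable M"
  unfolding score_def using skew_kernelsD(1)[of W M] by measurable

lemma kernel_section_integrable:
  assumes W: "W \<in> skew_kernels M" and x: "x \<in> space M"
  shows "integrable M (\<lambda>y. W (x, y))"
proof (rule integrable_bounded_real[where c = 1])
  note [measurable] = skew_kernelsD(1)[OF W]
  show "(\<lambda>y. W (x, y)) \<in> borel_measurable M" using x by measurable
qed (use skew_kernelsD(2,3)[OF W x] in auto)

lemma score_bounds:
  assumes W: "W \<in> skew_kernels M" and x: "x \<in> space M"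
  shows "0 \<le> score M W x" "score M W x \<le> 1"
proof -
  show "0 \<le> score M W x" unfolding score_def
    by (intro Bochner_Integration.integral_nonneg skew_kernelsD(2)[OF W x])
  have "score M W x \<le> (\<integral>y. 1 \<partial>M)" unfolding score_def
    by (intro integral_mono kernel_section_integrable[OF W x] skew_kernelsD(3)[OF W x]) simp
  then show "score M W x \<le> 1" by (simp add: prob_space)
qed

lemma score_convex:
  assumes W: "W \<in> skew_kernels M" and V: "V \<in> skew_kernels M" and x: "x \<in> space M"
  shows "score M (\<lambda>p. (1 - t) * W p + t * V p) x = (1 - t) * score M W x + t * score M V x"
  unfolding score_def
  by (subst Bochner_Integration.integral_add) (auto intro!: kernel_section_integrable W V x)

text \<open>By Fubini the integral of \<open>g x * V (x, y)\<close> does not change when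
  \<open>x\<close> and \<open>y\<close> are swapped. The two versions add up to
  \<open>max (g x) (g y)\<close> pointwise, because \<open>V\<close> gives all weight to the larger
  value; splitting ties evenly keeps \<open>V\<close> skew. No skew kernel does better, since the
  sum is always a weighted mean of \<open>g x\<close> and \<open>g y\<close>.\<close>

lemma score_greedy:
  fixes g :: "'a \<Rightarrow> real"
  assumes g[measurable]: "g \<in> borel_measurable M" and g1: "\<And>x. x \<in> space M \<Longrightarrow> \<bar>g x\<bar> \<le> 1"
  defines "V \<equiv> \<lambda>(x, y). if g y < g x then 1 else if g x = g y then 1 / 2 else (0::real)"
  shows "V \<in> skew_kernels M"
    and "2 * (\<integral>x. g x * score M V x \<partial>M) = (\<integral>x. (\<integral>y. max (g x) (g y) \<partial>M) \<partial>M)"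
proof -
  interpret PP: pair_prob_space M M ..
  have Vm[measurable]: "V \<in> borel_measurable (M \<Otimes>\<^sub>M M)"
    unfolding V_def by measurable
  show V: "V \<in> skew_kernels M"
    using Vm unfolding skew_kernels_def by (auto simp: V_def)
  have V1: "\<bar>V p\<bar> \<le> 1" for p by (auto simp: V_def split: prod.splits)
  have gV: "integrable (M \<Otimes>\<^sub>M M) (\<lambda>(x, y). g x * V (x, y))"
    by (rule PP.integrable_bounded_real[where c = 1])
      (use g1 V1 in \<open>auto simp: abs_mult space_pair_measure intro!: mult_le_one\<close>)
  have gV': "integrable (M \<Otimes>\<^sub>M M) (\<lambda>(x, y). g y * V (y, x))"
    by (rule PP.integrable_bounded_real[where c = 1])
      (use g1 V1 in \<open>auto simp: abs_mult space_pair_measure intro!: mult_le_one\<close>)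
  have 1: "(\<integral>x. g x * score M V x \<partial>M) = (\<integral>x. (\<integral>y. g x * V (x, y) \<partial>M) \<partial>M)"
    by (simp add: score_def)
  have "(\<integral>x. (\<integral>y. g x * V (x, y) \<partial>M) \<partial>M) = (\<integral>x. (\<integral>y. g y * V (y, x) \<partial>M) \<partial>M)"
    by (rule PP.Fubini_integral[OF gV'])
  note 2 = trans[OF 1 this]
  have "2 * (\<integral>x. g x * score M V x \<partial>M)
      = (\<integral>x. (\<integral>y. g x * V (x, y) \<partial>M) \<partial>M) + (\<integral>x. (\<integral>y. g y * V (y, x) \<partial>M) \<partial>M)"
    using 1 2 by linarith
  also have "\<dots> = (\<integral>x. (\<integral>y. g x * V (x, y) \<partial>M) + (\<integral>y. g y * V (y, x) \<partial>M) \<partial>M)"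
    using PP.integrable_fst[OF gV] PP.integrable_fst[OF gV']
    by (intro Bochner_Integration.integral_add[symmetric]) simp_all
  also have "\<dots> = (\<integral>x. (\<integral>y. max (g x) (g y) \<partial>M) \<partial>M)"
  proof (intro Bochner_Integration.integral_cong refl)
    fix x assume x: "x \<in> space M"
    have "(\<integral>y. g x * V (x, y) \<partial>M) + (\<integral>y. g y * V (y, x) \<partial>M)
        = (\<integral>y. g x * V (x, y) + g y * V (y, x) \<partial>M)"
    proof (intro Bochner_Integration.integral_add[symmetric])
      show "integrable M (\<lambda>y. g x * V (x, y))"
        by (intro integrable_mult_right kernel_section_integrable[OF V x])
      show "integrable M (\<lambda>y. g y * V (y, x))"
        by (rule integrable_bounded_real[where c = 1])
          (use g1 V1 x in \<open>auto simp: abs_mult intro!: mult_le_one\<close>)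
    qed
    also have "\<dots> = (\<integral>y. max (g x) (g y) \<partial>M)"
      by (intro Bochner_Integration.integral_cong refl) (auto simp: V_def max_def)
    finally show "(\<integral>y. g x * V (x, y) \<partial>M) + (\<integral>y. g y * V (y, x) \<partial>M)
        = (\<integral>y. max (g x) (g y) \<partial>M)" .
  qed
  finally show "2 * (\<integral>x. g x * score M V x \<partial>M) = (\<integral>x. (\<integral>y. max (g x) (g y) \<partial>M) \<partial>M)" .
qed

lemma score_error_bounds:
  assumes f[measurable]: "f \<in> borel_measurable M" and f01: "\<And>x. x \<in> space M \<Longrightarrow> f x \<in> {0..1}"
    and W: "W \<in> skew_kernels M"
  shows "0 \<le> score_error M f W" "score_error M f W \<le> 1"
    and "integrable M (\<lambda>x. (score M W x - f x)\<^sup>2)"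
proof -
  note [measurable] = score_measurable[OF W]
  have le: "(score M W x - f x)\<^sup>2 \<le> 1" if "x \<in> space M" for x
    using score_bounds[OF W that] f01[OF that] by (intro abs_square_le_1[THEN iffD2]) auto
  show int: "integrable M (\<lambda>x. (score M W x - f x)\<^sup>2)"
    by (rule integrable_bounded_real[where c = 1]) (use le in auto)
  show "0 \<le> score_error M f W" unfolding score_error_def by simp
  have "score_error M f W \<le> (\<integral>x. 1 \<partial>M)" unfolding score_error_def
    by (intro integral_mono int le) simp
  then show "score_error M f W \<le> 1" by (simp add: prob_space)
qed

text \<open>Scores are affine in the kernel and the square is convex. This makes the sublevel sets
  closed under midpoints, which the parallelogram argument needs; the coefficient
  \<open>1 - 1/2\<close> keeps the shape of \<open>skew_kernels_convex\<close>.\<close>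

lemma score_error_convex:
  assumes f[measurable]: "f \<in> borel_measurable M" and f01: "\<And>x. x \<in> space M \<Longrightarrow> f x \<in> {0..1}"
    and W: "W \<in> skew_kernels M" and V: "V \<in> skew_kernels M"
    and e: "score_error M f W \<le> e" "score_error M f V \<le> e"
  shows "score_error M f (\<lambda>p. (1 - 1/2) * W p + (1/2) * V p) \<le> e"
proof -
  note [measurable] = score_measurable[OF W] score_measurable[OF V]
  let ?U = "\<lambda>p. (1 - 1/2) * W p + (1/2) * V p"
  have U: "?U \<in> skew_kernels M" by (intro skew_kernels_convex W V) simp
  have "score_error M f ?U \<le> (\<integral>x. (score M W x - f x)\<^sup>2 / 2 + (score M V x - f x)\<^sup>2 / 2 \<partial>M)"
    unfolding score_error_def
  proof (intro integral_mono score_error_bounds(3)[OF f f01] Bochner_Integration.integrable_add integrable_divide)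
    fix x assume x: "x \<in> space M"
    have "0 \<le> ((score M W x - f x) - (score M V x - f x))\<^sup>2" by simp
    then show "(score M ?U x - f x)\<^sup>2 \<le> (score M W x - f x)\<^sup>2 / 2 + (score M V x - f x)\<^sup>2 / 2"
      unfolding score_convex[OF W V x] by (simp add: power2_eq_square field_simps)
  qed (use U W V in simp_all)
  also have "\<dots> = score_error M f W / 2 + score_error M f V / 2"
    unfolding score_error_def
    by (subst Bochner_Integration.integral_add)
      (auto intro!: score_error_bounds(3)[OF f f01] W V)
  finally show ?thesis using e by simp
qed

text \<open>On the segment from \<open>W\<close> to \<open>V\<close> the error is quadratic in
  \<open>t\<close>. With \<open>g = f - score M W\<close>, its slope at 0 is -2 times the integral
  of \<open>g * (score M V - score M W)\<close>. The choice of \<open>V\<close> makes that integral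
  at least the integral of \<open>g * (f - score M W)\<close>, which is the error itself. The
  quadratic coefficient is at most 1, as scores lie in [0,1].\<close>

lemma score_error_descent:
  assumes f[measurable]: "f \<in> borel_measurable M" and f01: "\<And>x. x \<in> space M \<Longrightarrow> f x \<in> {0..1}"
    and lower: "\<And>B. B \<in> sets M \<Longrightarrow> (prob B)\<^sup>2 / 2 \<le> (\<integral>x. indicator B x * f x \<partial>M)"
    and total: "(\<integral>x. f x \<partial>M) = 1 / 2"
    and W: "W \<in> skew_kernels M"
  obtains V where "V \<in> skew_kernels M"
    and "\<And>t. t \<in> {0..1} \<Longrightarrow> score_error M f (\<lambda>p. (1 - t) * W p + t * V p)
          \<le> score_error M f W - 2 * t * score_error M f W + t\<^sup>2"
proof -
  note [measurable] = score_measurable[OF W]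
  define g where "g x = f x - score M W x" for x
  have gm[measurable]: "g \<in> borel_measurable M" unfolding g_def by measurable
  have g1: "\<bar>g x\<bar> \<le> 1" if "x \<in> space M" for x
    using f01[OF that] score_bounds[OF W that] by (auto simp: g_def)
  define V where "V = (\<lambda>(x, y). if g y < g x then 1 else if g x = g y then 1 / 2 else (0::real))"
  have V: "V \<in> skew_kernels M" unfolding V_def by (rule score_greedy(1)[OF gm g1])
  note [measurable] = score_measurable[OF V]
  have gint: "integrable M (\<lambda>x. g x * h x)"
    if "h \<in> borel_measurable M" "\<And>x. x \<in> space M \<Longrightarrow> \<bar>h x\<bar> \<le> 1" for h
    by (rule integrable_bounded_real[where c = 1])
      (use g1 that in \<open>auto simp: abs_mult intro!: mult_le_one\<close>)
  \<comment> \<open>Negating \<open>g\<close> turns the lower bound by minima into an upper bound by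
    maxima, which is the value attained by the greedy kernel.\<close>
  have "(\<integral>x. (\<integral>y. min (- g x) (- g y) \<partial>M) \<partial>M) / 2 - 3 * 0 \<le> (\<integral>x. - g x * f x \<partial>M)"
    by (rule layer_cake_min) (use f01 g1 lower total in auto)
  moreover have "(\<integral>x. (\<integral>y. min (- g x) (- g y) \<partial>M) \<partial>M) = - (\<integral>x. (\<integral>y. max (g x) (g y) \<partial>M) \<partial>M)"
    by (simp flip: minus_max_eq_min)
  moreover have "2 * (\<integral>x. g x * score M V x \<partial>M) = (\<integral>x. (\<integral>y. max (g x) (g y) \<partial>M) \<partial>M)"
    unfolding V_def by (rule score_greedy(2)[OF gm g1])
  ultimately have gV: "(\<integral>x. g x * f x \<partial>M) \<le> (\<integral>x. g x * score M V x \<partial>M)"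
    by simp
  have err: "score_error M f W = (\<integral>x. g x * g x \<partial>M)"
    unfolding score_error_def g_def by (simp add: power2_eq_square algebra_simps)
  also have "\<dots> = (\<integral>x. g x * f x - g x * score M W x \<partial>M)"
    by (simp add: g_def algebra_simps)
  also have "\<dots> = (\<integral>x. g x * f x \<partial>M) - (\<integral>x. g x * score M W x \<partial>M)"
    by (intro Bochner_Integration.integral_diff gint) (use f01 score_bounds[OF W] in auto)
  also have "\<dots> \<le> (\<integral>x. g x * score M V x \<partial>M) - (\<integral>x. g x * score M W x \<partial>M)"
    using gV by simp
  also have "\<dots> = (\<integral>x. g x * (score M V x - score M W x) \<partial>M)"
    by (subst Bochner_Integration.integral_diff[symmetric])
      (auto intro!: gint simp: algebra_simps, use score_bounds[OF W] score_bounds[OF V] in auto)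
  finally have *: "score_error M f W \<le> (\<integral>x. g x * (score M V x - score M W x) \<partial>M)" .
  show thesis
  proof (rule that[OF V])
    fix t :: real assume t: "t \<in> {0..1}"
    have i1: "integrable M (\<lambda>x. g x * g x)" using g1 by (intro gint) auto
    have i2: "integrable M (\<lambda>x. g x * (score M V x - score M W x))"
    proof (intro gint)
      show "\<bar>score M V x - score M W x\<bar> \<le> 1" if "x \<in> space M" for x
        using score_bounds[OF W that] score_bounds[OF V that] by auto
    qed measurable
    have sq: "(score M V x - score M W x)\<^sup>2 \<le> 1" if "x \<in> space M" for x
      using score_bounds[OF W that] score_bounds[OF V that]
      by (intro abs_square_le_1[THEN iffD2]) auto
    have "score_error M f (\<lambda>p. (1 - t) * W p + t * V p)
        \<le> (\<integral>x. g x * g x - 2 * t * (g x * (score M V x - score M W x)) + t\<^sup>2 \<partial>M)"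
      unfolding score_error_def
    proof (intro integral_mono score_error_bounds(3)[OF f f01] skew_kernels_convex W V t)
      show "integrable M (\<lambda>x. g x * g x - 2 * t * (g x * (score M V x - score M W x)) + t\<^sup>2)"
        using i1 i2 by simp
      fix x assume x: "x \<in> space M"
      have "(score M (\<lambda>p. (1 - t) * W p + t * V p) x - f x)\<^sup>2
          = g x * g x - 2 * t * (g x * (score M V x - score M W x)) + t\<^sup>2 * (score M V x - score M W x)\<^sup>2"
        unfolding score_convex[OF W V x] g_def by (simp add: power2_eq_square algebra_simps)
      also have "t\<^sup>2 * (score M V x - score M W x)\<^sup>2 \<le> t\<^sup>2 * 1"
        by (intro mult_left_mono sq x) simp
      finally show "(score M (\<lambda>p. (1 - t) * W p + t * V p) x - f x)\<^sup>2
          \<le> g x * g x - 2 * t * (g x * (score M V x - score M W x)) + t\<^sup>2" by simp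
    qed auto
    also have "\<dots> = score_error M f W - 2 * t * (\<integral>x. g x * (score M V x - score M W x) \<partial>M) + t\<^sup>2"
      using i1 i2 by (simp add: err prob_space)
    also have "\<dots> \<le> score_error M f W - 2 * t * score_error M f W + t\<^sup>2"
      using t * by (auto intro: mult_left_mono)
    finally show "score_error M f (\<lambda>p. (1 - t) * W p + t * V p)
        \<le> score_error M f W - 2 * t * score_error M f W + t\<^sup>2" .
  qed
qed

text \<open>If the infimum D were positive, take \<open>W\<close> with error below D + D^2 and move
  by \<open>t = D\<close>, which minimises -2tD + t^2 and is admissible because D \<le> 1. The error
  drops by at least D^2, to below D.\<close>

lemma score_error_arbitrarily_small:
  assumes f[measurable]: "f \<in> borel_measurable M" and f01: "\<And>x. x \<in> space M \<Longrightarrow> f x \<in> {0..1}"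
    and lower: "\<And>B. B \<in> sets M \<Longrightarrow> (prob B)\<^sup>2 / 2 \<le> (\<integral>x. indicator B x * f x \<partial>M)"
    and total: "(\<integral>x. f x \<partial>M) = 1 / 2"
    and \<delta>: "0 < \<delta>"
  shows "\<exists>W\<in>skew_kernels M. score_error M f W \<le> \<delta>"
proof (rule ccontr)
  assume no: "\<not> ?thesis"
  define D where "D = (INF W\<in>skew_kernels M. score_error M f W)"
  have half: "(\<lambda>p. 1 / 2) \<in> skew_kernels M" by (simp add: skew_kernels_def)
  have bdd: "bdd_below (score_error M f ` skew_kernels M)"
    using score_error_bounds(1)[OF f f01] by (auto intro!: bdd_belowI)
  have D_le: "D \<le> score_error M f W" if "W \<in> skew_kernels M" for W
    unfolding D_def by (intro cINF_lower bdd that)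
  have "\<delta> \<le> D" unfolding D_def
    by (rule cINF_greatest) (use half no in \<open>auto simp: not_le less_imp_le\<close>)
  then have D: "0 < D" "D \<le> 1"
    using \<delta> D_le[OF half] score_error_bounds(2)[OF f f01 half] by auto
  have "\<exists>W\<in>skew_kernels M. score_error M f W < D + D\<^sup>2"
    using cINF_less_iff[OF _ bdd, of "D + D\<^sup>2"] half D unfolding D_def[symmetric] by auto
  then obtain W where W: "W \<in> skew_kernels M" "score_error M f W < D + D\<^sup>2" by blast
  obtain V where V: "V \<in> skew_kernels M"
    and step: "\<And>t. t \<in> {0..1} \<Longrightarrow> score_error M f (\<lambda>p. (1 - t) * W p + t * V p)
          \<le> score_error M f W - 2 * t * score_error M f W + t\<^sup>2"
    using score_error_descent[OF f f01 lower total W(1)] by blast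
  have "D \<le> score_error M f (\<lambda>p. (1 - D) * W p + D * V p)"
    by (intro D_le skew_kernels_convex W V) (use D in auto)
  also have "\<dots> \<le> score_error M f W - 2 * D * score_error M f W + D\<^sup>2"
    using D by (intro step) auto
  also have "\<dots> \<le> score_error M f W - D\<^sup>2"
    using mult_left_mono[OF D_le[OF W(1)], of D] D by (simp add: power2_eq_square)
  finally show False using W(2) by simp
qed

section \<open>Attaining the infimum: almost sure limits of kernels of nearly minimal norm\<close>

lemma expectation_abs_square_le:
  fixes X :: "'a \<Rightarrow> real"
  assumes "X \<in> borel_measurable M" "\<And>x. x \<in> space M \<Longrightarrow> \<bar>X x\<bar> \<le> 1"
  shows "(\<integral>x. \<bar>X x\<bar> \<partial>M)\<^sup>2 \<le> (\<integral>x. (X x)\<^sup>2 \<partial>M)"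
proof -
  note [measurable] = assms(1)
  have "0 \<le> variance (\<lambda>x. \<bar>X x\<bar>)" by (rule variance_positive)
  also have "\<dots> = (\<integral>x. \<bar>X x\<bar>\<^sup>2 \<partial>M) - (\<integral>x. \<bar>X x\<bar> \<partial>M)\<^sup>2"
    by (intro variance_eq integrable_bounded_real[where c = 1])
      (use assms(2) in \<open>auto simp: abs_square_le_1\<close>)
  finally show ?thesis by simp
qed

text \<open>The sum of the absolute increments has finite expectation, so it is finite almost
  everywhere, and there the telescoping series converges absolutely.\<close>

lemma AE_convergent_of_summable_differences:
  fixes X :: "nat \<Rightarrow> 'a \<Rightarrow> real"
  assumes X[measurable]: "\<And>n. X n \<in> borel_measurable M"
    and int: "\<And>n. integrable M (\<lambda>x. \<bar>X (Suc n) x - X n x\<bar>)"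
    and le: "\<And>n. (\<integral>x. \<bar>X (Suc n) x - X n x\<bar> \<partial>M) \<le> c n" and c: "summable c"
  shows "AE x in M. convergent (\<lambda>n. X n x)"
proof -
  have c0: "0 \<le> c n" for n
    by (rule order_trans[OF _ le]) simp
  have "(\<integral>\<^sup>+x. (\<Sum>n. ennreal \<bar>X (Suc n) x - X n x\<bar>) \<partial>M)
      = (\<Sum>n. \<integral>\<^sup>+x. ennreal \<bar>X (Suc n) x - X n x\<bar> \<partial>M)"
    by (rule nn_integral_suminf) measurable
  also have "\<dots> \<le> (\<Sum>n. ennreal (c n))"
    by (intro suminf_le) (auto simp: nn_integral_eq_integral[OF int] ennreal_leI le)
  also have "\<dots> < \<infinity>"
    using ennreal_suminf_neq_top[OF c c0] by (simp add: less_top)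
  finally have "(\<integral>\<^sup>+x. (\<Sum>n. ennreal \<bar>X (Suc n) x - X n x\<bar>) \<partial>M) \<noteq> \<infinity>"
    by (rule less_imp_neq)
  then have "AE x in M. (\<Sum>n. ennreal \<bar>X (Suc n) x - X n x\<bar>) \<noteq> \<infinity>"
    by (rule nn_integral_PInf_AE[rotated]) measurable
  then show ?thesis
  proof eventually_elim
    case (elim x)
    then have "summable (\<lambda>n. \<bar>X (Suc n) x - X n x\<bar>)"
      unfolding infinity_ennreal_def by (rule summable_suminf_not_top[rotated]) (rule abs_ge_zero)
    then have "summable (\<lambda>n. X (Suc n) x - X n x)"
      by (rule summable_rabs_cancel)
    then have "convergent (\<lambda>n. \<Sum>i<n. X (Suc i) x - X i x)"
      by (simp add: summable_iff_convergent)
    then have "convergent (\<lambda>n. X n x - X 0 x)"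
      by (simp add: sum_lessThan_telescope[of "\<lambda>n. X n x"])
    then have "convergent (\<lambda>n. X n x - X 0 x + X 0 x)"
      by (intro convergent_add convergent_const)
    then show ?case by simp
  qed
qed

lemma skew_kernel_nrm:
  assumes W: "W \<in> skew_kernels M"
  shows "integrable (M \<Otimes>\<^sub>M M) (\<lambda>p. (W p)\<^sup>2)"
    and "0 \<le> (\<integral>p. (W p)\<^sup>2 \<partial>(M \<Otimes>\<^sub>M M))" and "(\<integral>p. (W p)\<^sup>2 \<partial>(M \<Otimes>\<^sub>M M)) \<le> 1"
proof -
  interpret PP: pair_prob_space M M ..
  note [measurable] = skew_kernelsD(1)[OF W]
  have le: "(W p)\<^sup>2 \<le> 1" if "p \<in> space (M \<Otimes>\<^sub>M M)" for p
    using skew_kernelsD(2,3)[OF W, of "fst p" "snd p"] that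
    by (auto simp: space_pair_measure power_le_one)
  show int: "integrable (M \<Otimes>\<^sub>M M) (\<lambda>p. (W p)\<^sup>2)"
    by (rule PP.integrable_bounded_real[where c = 1]) (use le in auto)
  show "0 \<le> (\<integral>p. (W p)\<^sup>2 \<partial>(M \<Otimes>\<^sub>M M))" by simp
  have "(\<integral>p. (W p)\<^sup>2 \<partial>(M \<Otimes>\<^sub>M M)) \<le> (\<integral>p. 1 \<partial>(M \<Otimes>\<^sub>M M))"
    by (intro integral_mono int le) simp
  then show "(\<integral>p. (W p)\<^sup>2 \<partial>(M \<Otimes>\<^sub>M M)) \<le> 1" by (simp add: PP.prob_space)
qed

lemma skew_kernel_parallelogram:
  assumes W: "W \<in> skew_kernels M" and V: "V \<in> skew_kernels M"
  shows "(\<integral>p. (W p - V p)\<^sup>2 \<partial>(M \<Otimes>\<^sub>M M))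
    = 2 * (\<integral>p. (W p)\<^sup>2 \<partial>(M \<Otimes>\<^sub>M M)) + 2 * (\<integral>p. (V p)\<^sup>2 \<partial>(M \<Otimes>\<^sub>M M))
      - 4 * (\<integral>p. ((1 - 1/2) * W p + (1/2) * V p)\<^sup>2 \<partial>(M \<Otimes>\<^sub>M M))"
proof -
  have U: "(\<lambda>p. (1 - 1/2) * W p + (1/2) * V p) \<in> skew_kernels M"
    by (intro skew_kernels_convex W V) simp
  have "(\<lambda>p. (W p - V p)\<^sup>2)
      = (\<lambda>p. 2 * (W p)\<^sup>2 + 2 * (V p)\<^sup>2 - 4 * ((1 - 1/2) * W p + (1/2) * V p)\<^sup>2)"
    by (simp add: fun_eq_iff power2_eq_square field_simps)
  then show ?thesis
    using skew_kernel_nrm(1)[OF U] skew_kernel_nrm(1)[OF W] skew_kernel_nrm(1)[OF V] by simp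
qed

text \<open>
  Among the kernels with score error at most \<open>1 / Suc n\<close>, a nested sequence of convex sets, pick
  ones of almost minimal \<open>L\<^sup>2\<close> norm; by the parallelogram law they form a Cauchy sequence.
\<close>

lemma skew_kernel_minimizing_sequence:
  assumes f: "f \<in> borel_measurable M" and f01: "\<And>x. x \<in> space M \<Longrightarrow> f x \<in> {0..1}"
    and ex: "\<And>\<delta>. 0 < \<delta> \<Longrightarrow> \<exists>W\<in>skew_kernels M. score_error M f W \<le> \<delta>"
  obtains W where "\<And>j. W j \<in> skew_kernels M"
    and "\<And>j. score_error M f (W j) \<le> 1 / Suc j"
    and "\<And>j. (\<integral>p. \<bar>W (Suc j) p - W j p\<bar> \<partial>(M \<Otimes>\<^sub>M M)) \<le> (1 / 2) ^ j"
proof -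
  interpret PP: pair_prob_space M M ..
  define C where "C n = {W \<in> skew_kernels M. score_error M f W \<le> 1 / Suc n}" for n :: nat
  define nrm where "nrm W = (\<integral>p. (W p)\<^sup>2 \<partial>(M \<Otimes>\<^sub>M M))" for W :: "'a \<times> 'a \<Rightarrow> real"
  define m where "m n = (INF W\<in>C n. nrm W)" for n
  have ne: "C n \<noteq> {}" for n using ex[of "1 / Suc n"] by (auto simp: C_def)
  have nrm01: "0 \<le> nrm W" "nrm W \<le> 1" if "W \<in> C n" for W n
    using skew_kernel_nrm(2,3)[of W] that by (auto simp: C_def nrm_def)
  have bdd: "bdd_below (nrm ` C n)" for n using nrm01(1) by (auto intro!: bdd_belowI)
  have m_le: "m n \<le> nrm W" if "W \<in> C n" for W n
    unfolding m_def by (intro cINF_lower bdd that)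
  have nested: "C k \<subseteq> C n" if "n \<le> k" for n k
  proof -
    have "1 / real (Suc k) \<le> 1 / real (Suc n)" using that by (intro divide_left_mono) auto
    then show ?thesis by (auto simp: C_def)
  qed
  \<comment> \<open>The sets shrink, so the minimal squared norms increase; they are bounded by 1
    and therefore have a limit, approached from below.\<close>
  have "incseq m" unfolding m_def
    by (intro incseq_SucI cINF_superset_mono ne bdd nested) auto
  moreover have "m n \<le> 1" for n using m_le nrm01(2) ne by (meson equals0I order_trans)
  ultimately obtain L where L: "m \<longlonglongrightarrow> L" "\<And>n. m n \<le> L"
    using incseq_convergent[of m 1] by blast
  \<comment> \<open>Both kernels have squared norm at most L + \<epsilon>, their midpoint at least L
    - \<epsilon>, so the parallelogram law bounds the squared distance by 2(L + \<epsilon>) + 2(L +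
    \<epsilon>) - 4(L - \<epsilon>) = 8\<epsilon>. This is to be the square of the summable bound
    \<open>(1 / 2) ^ j\<close>.\<close>
  define \<epsilon> where "\<epsilon> j = (1 / 4) ^ j / (8::real)" for j :: nat
  have \<epsilon>: "0 < \<epsilon> j" "\<epsilon> (Suc j) \<le> \<epsilon> j" "8 * \<epsilon> j = ((1 / 2) ^ j)\<^sup>2" for j
    by (simp_all add: \<epsilon>_def field_simps flip: power_mult_distrib power2_eq_square)
      (simp add: power2_eq_square flip: power_mult_distrib)
  have "\<exists>k. \<forall>i\<ge>k. L - \<epsilon> j < m i" for j
    using order_tendstoD(1)[OF L(1), of "L - \<epsilon> j"] \<epsilon>(1)[of j] by (auto simp: eventually_sequentially)
  then obtain k where k: "\<And>i j. k j \<le> i \<Longrightarrow> L - \<epsilon> j < m i" by metis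
  \<comment> \<open>One index with three duties: it dominates \<open>k j\<close>, so the minimal
    norm is within \<epsilon> of the limit; it dominates \<open>j\<close>, which controls the score
    error; and it increases with \<open>j\<close>, so that \<open>W (Suc j)\<close> also lies in
    \<open>C (K j)\<close>.\<close>
  define K where "K j = (\<Sum>i\<le>j. Suc (k i))" for j
  have K: "k j \<le> K j" "j \<le> K j" "K j \<le> K (Suc j)" for j
  proof -
    show "k j \<le> K j" by (cases j) (auto simp: K_def)
    show "j \<le> K j" by (induction j) (auto simp: K_def)
    show "K j \<le> K (Suc j)" by (simp add: K_def)
  qed
  have "\<exists>W\<in>C (K j). nrm W < m (K j) + \<epsilon> j" for j
    using cINF_less_iff[OF ne bdd, of "K j" "m (K j) + \<epsilon> j"] \<epsilon>(1)[of j] unfolding m_def[symmetric] by auto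
  then obtain W where W: "\<And>j. W j \<in> C (K j)" "\<And>j. nrm (W j) < m (K j) + \<epsilon> j" by metis
  have sk: "W j \<in> skew_kernels M" for j using W(1)[of j] by (simp add: C_def)
  show thesis
  proof (rule that[of W])
    fix j
    show "W j \<in> skew_kernels M" by (rule sk)
    show "score_error M f (W j) \<le> 1 / Suc j"
      using nested[OF K(2)[of j]] W(1)[of j] by (auto simp: C_def)
    have in_C: "W (Suc j) \<in> C (K j)" "W j \<in> C (K j)"
      using W(1) nested[OF K(3)[of j]] by auto
    have "(\<lambda>p. (1 - 1/2) * W (Suc j) p + (1/2) * W j p) \<in> C (K j)"
      unfolding C_def using in_C
      by (auto simp only: C_def mem_Collect_eq intro!: skew_kernels_convex score_error_convex[OF f f01]) auto
    then have "L - \<epsilon> j \<le> nrm (\<lambda>p. (1 - 1/2) * W (Suc j) p + (1/2) * W j p)"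
      using m_le[of _ "K j"] k[OF K(1)[of j]] by (meson less_imp_le order_trans)
    moreover have "nrm (W j) \<le> L + \<epsilon> j" "nrm (W (Suc j)) \<le> L + \<epsilon> j"
      using W(2)[of j] W(2)[of "Suc j"] L(2)[of "K j"] L(2)[of "K (Suc j)"] \<epsilon>(2)[of j] by linarith+
    ultimately have "(\<integral>p. (W (Suc j) p - W j p)\<^sup>2 \<partial>(M \<Otimes>\<^sub>M M)) \<le> 8 * \<epsilon> j"
      unfolding skew_kernel_parallelogram[OF sk sk] nrm_def by linarith
    moreover have "(\<integral>p. \<bar>W (Suc j) p - W j p\<bar> \<partial>(M \<Otimes>\<^sub>M M))\<^sup>2 \<le> (\<integral>p. (W (Suc j) p - W j p)\<^sup>2 \<partial>(M \<Otimes>\<^sub>M M))"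
    proof (rule PP.expectation_abs_square_le)
      show "(\<lambda>p. W (Suc j) p - W j p) \<in> borel_measurable (M \<Otimes>\<^sub>M M)"
        using skew_kernelsD(1)[OF sk] by measurable
      fix p assume "p \<in> space (M \<Otimes>\<^sub>M M)"
      then show "\<bar>W (Suc j) p - W j p\<bar> \<le> 1"
        using skew_kernelsD(2,3)[OF sk[of j], of "fst p" "snd p"]
          skew_kernelsD(2,3)[OF sk[of "Suc j"], of "fst p" "snd p"]
        by (auto simp: space_pair_measure abs_le_iff)
    qed
    ultimately have "(\<integral>p. \<bar>W (Suc j) p - W j p\<bar> \<partial>(M \<Otimes>\<^sub>M M))\<^sup>2 \<le> ((1 / 2) ^ j)\<^sup>2"
      using \<epsilon>(3)[of j] by linarith
    then show "(\<integral>p. \<bar>W (Suc j) p - W j p\<bar> \<partial>(M \<Otimes>\<^sub>M M)) \<le> (1 / 2) ^ j"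
      by (rule power2_le_imp_le) simp
  qed
qed

text \<open>The L^1 distances of successive kernels are summable, so the kernels converge at almost
  every pair. By Fubini almost every section converges almost everywhere, and bounded convergence
  carries first the scores and then the score error, which tends to 0, over to the limit.\<close>

theorem skew_kernel_with_score:
  assumes f[measurable]: "f \<in> borel_measurable M" and f01: "\<And>x. x \<in> space M \<Longrightarrow> f x \<in> {0..1}"
    and lower: "\<And>B. B \<in> sets M \<Longrightarrow> (prob B)\<^sup>2 / 2 \<le> (\<integral>x. indicator B x * f x \<partial>M)"
    and total: "(\<integral>x. f x \<partial>M) = 1 / 2"
  obtains W where "W \<in> skew_kernels M" and "AE x in M. score M W x = f x"
proof -
  interpret PP: pair_prob_space M M ..
  obtain W where sk: "\<And>j. W j \<in> skew_kernels M"
    and err: "\<And>j. score_error M f (W j) \<le> 1 / Suc j"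
    and diff: "\<And>j. (\<integral>p. \<bar>W (Suc j) p - W j p\<bar> \<partial>(M \<Otimes>\<^sub>M M)) \<le> (1 / 2) ^ j"
    using skew_kernel_minimizing_sequence[OF f f01 score_error_arbitrarily_small[OF f f01 lower total]]
    by blast
  note Wm[measurable] = skew_kernelsD(1)[OF sk]
  have conv: "AE p in M \<Otimes>\<^sub>M M. convergent (\<lambda>j. W j p)"
  proof (rule PP.AE_convergent_of_summable_differences[where X = W and c = "\<lambda>j. (1 / 2) ^ j", OF Wm _ diff])
    show "summable (\<lambda>j. (1 / 2) ^ j :: real)" by (simp add: summable_geometric)
    show "integrable (M \<Otimes>\<^sub>M M) (\<lambda>p. \<bar>W (Suc j) p - W j p\<bar>)" for j
    proof (rule PP.integrable_bounded_real[where c = 1])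
      fix p assume "p \<in> space (M \<Otimes>\<^sub>M M)"
      then show "\<bar>\<bar>W (Suc j) p - W j p\<bar>\<bar> \<le> 1"
        using skew_kernelsD(2,3)[OF sk[of j], of "fst p" "snd p"]
          skew_kernelsD(2,3)[OF sk[of "Suc j"], of "fst p" "snd p"]
        by (auto simp: space_pair_measure abs_le_iff)
    qed measurable
  qed
  \<comment> \<open>Where the sequence diverges at (x, y) it also diverges at (y, x), as the terms
    there are 1 minus the original ones; the default 1/2 thus keeps \<open>V\<close> skew
    everywhere. The Cauchy condition is a countable combination of conditions on finitely many
    terms, which makes the case distinction measurable.\<close>
  define V where "V p = (if Cauchy (\<lambda>j. W j p) then lim (\<lambda>j. W j p) else 1 / 2)" for p
  have V_lim: "(\<lambda>j. W j p) \<longlonglongrightarrow> V p" if "convergent (\<lambda>j. W j p)" for p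
    using that by (simp add: V_def convergent_LIMSEQ_iff Cauchy_convergent_iff)
  have Vm[measurable]: "V \<in> borel_measurable (M \<Otimes>\<^sub>M M)"
    unfolding V_def by measurable
  have V: "V \<in> skew_kernels M"
    unfolding skew_kernels_def
  proof (intro CollectI conjI ballI Vm)
    fix x y assume xy: "x \<in> space M" "y \<in> space M"
    have sym: "W j (y, x) = 1 - W j (x, y)" for j
      using skew_kernelsD(4)[OF sk xy, of j] by simp
    have c: "convergent (\<lambda>j. W j (y, x)) \<longleftrightarrow> convergent (\<lambda>j. W j (x, y))"
      unfolding sym using convergent_diff[OF convergent_const[of 1], of "\<lambda>j. W j (x, y)"]
        convergent_diff[OF convergent_const[of 1], of "\<lambda>j. 1 - W j (x, y)"] by auto
    have "V (x, y) \<in> {0..1} \<and> V (x, y) + V (y, x) = 1"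
    proof (cases "convergent (\<lambda>j. W j (x, y))")
      case True
      note lims = V_lim[OF True] V_lim[OF True[folded c]]
      have "0 \<le> V (x, y)" "V (x, y) \<le> 1"
        using skew_kernelsD(2,3)[OF sk xy]
        by (auto intro: LIMSEQ_le_const[OF lims(1)] LIMSEQ_le_const2[OF lims(1)])
      moreover have "(\<lambda>j. 1) \<longlonglongrightarrow> V (x, y) + V (y, x)"
        using tendsto_add[OF lims] skew_kernelsD(4)[OF sk xy] by simp
      ultimately show ?thesis by (simp add: LIMSEQ_const_iff)
    next
      case False
      with c show ?thesis by (simp add: V_def Cauchy_convergent_iff)
    qed
    then show "V (x, y) \<in> {0..1}" "V (x, y) + V (y, x) = 1" by auto
  qed
  have "AE x in M. AE y in M. convergent (\<lambda>j. W j (x, y))"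
    by (rule PP.AE_pair[OF conv])
  then have lim: "AE x in M. (\<lambda>j. score M (W j) x) \<longlonglongrightarrow> score M V x"
    using AE_space
  proof eventually_elim
    case (elim x)
    show ?case unfolding score_def
    proof (rule integral_dominated_convergence[where w = "\<lambda>_. 1"])
      show "(\<lambda>y. V (x, y)) \<in> borel_measurable M" "(\<lambda>y. W j (x, y)) \<in> borel_measurable M" for j
        using elim(2) by measurable
      show "AE y in M. (\<lambda>j. W j (x, y)) \<longlonglongrightarrow> V (x, y)"
        using elim(1) by eventually_elim (auto intro: V_lim)
      show "AE y in M. norm (W j (x, y)) \<le> 1" for j
        using skew_kernelsD(2,3)[OF sk elim(2), of _ j] by (intro AE_I2) auto
    qed simp
  qed
  note [measurable] = score_measurable[OF sk] score_measurable[OF V]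
  have "(\<lambda>j. score_error M f (W j)) \<longlonglongrightarrow> score_error M f V"
    unfolding score_error_def
  proof (rule integral_dominated_convergence[where w = "\<lambda>_. 1"])
    show "AE x in M. (\<lambda>j. (score M (W j) x - f x)\<^sup>2) \<longlonglongrightarrow> (score M V x - f x)\<^sup>2"
      using lim by eventually_elim (intro tendsto_intros)
    show "AE x in M. norm ((score M (W j) x - f x)\<^sup>2) \<le> 1" for j
      using score_bounds[OF sk, of _ j] f01 by (intro AE_I2) (force simp: abs_square_le_1 abs_le_iff)
  qed measurable
  moreover have "(\<lambda>j. score_error M f (W j)) \<longlonglongrightarrow> 0"
  proof (rule tendsto_sandwich[OF _ _ tendsto_const])
    show "\<forall>\<^sub>F j in sequentially. 0 \<le> score_error M f (W j)"
      using score_error_bounds(1)[OF f f01 sk] by simp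
    show "\<forall>\<^sub>F j in sequentially. score_error M f (W j) \<le> 1 / Suc j" using err by simp
    show "(\<lambda>j. 1 / real (Suc j)) \<longlonglongrightarrow> 0" by (rule LIMSEQ_Suc) (rule lim_1_over_n)
  qed
  ultimately have "score_error M f V = 0" by (rule LIMSEQ_unique)
  then have "AE x in M. (score M V x - f x)\<^sup>2 = 0"
    unfolding score_error_def
    by (subst (asm) integral_nonneg_eq_0_iff_AE) (use score_error_bounds(3)[OF f f01 V] in auto)
  then have "AE x in M. score M V x = f x" by eventually_elim simp
  then show thesis by (rule that[OF V])
qed

end

section \<open>Lebesgue measurable kernels on the unit square\<close>

context prob_space
begin

lemma AE_swap:
  assumes "AE p in M \<Otimes>\<^sub>M M. P p"
  shows "AE p in M \<Otimes>\<^sub>M M. P (snd p, fst p)"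
proof -
  interpret PP: pair_prob_space M M ..
  have "AE p in distr (M \<Otimes>\<^sub>M M) (M \<Otimes>\<^sub>M M) (\<lambda>(x, y). (y, x)). P p"
    by (subst PP.distr_pair_swap[symmetric]) (rule assms)
  then have "AE p in M \<Otimes>\<^sub>M M. P (case p of (x, y) \<Rightarrow> (y, x))"
    by (rule AE_distrD[rotated]) measurable
  then show ?thesis by (simp add: case_prod_unfold)
qed

lemma AE_fst:
  assumes "AE x in M. P x"
  shows "AE p in M \<Otimes>\<^sub>M M. P (fst p)"
proof -
  interpret PP: pair_prob_space M M ..
  have "AE x in distr (M \<Otimes>\<^sub>M M) M fst. P x"
    by (subst distr_pair_fst) (rule assms)
  then show ?thesis by (rule AE_distrD[rotated]) measurable
qed

end

text \<open>A density on the whole space instead of a restricted space: the measurable sets are then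
  all Borel sets, and Borel functions on the line or the plane can be used unchanged.\<close>

definition unif_on :: "'a::euclidean_space set \<Rightarrow> 'a measure" where
  "unif_on S = density lborel (indicator S)"

lemma sets_unif_on [measurable_cong, simp]: "sets (unif_on S) = sets borel"
  and space_unif_on [simp]: "space (unif_on S) = UNIV"
  by (simp_all add: unif_on_def)

lemma prob_space_unif_unit: "prob_space (unif_on {0..1::real})"
  by (rule prob_spaceI) (simp add: unif_on_def emeasure_density)

interpretation unif: prob_space "unif_on {0..1::real}"
  by (rule prob_space_unif_unit)

interpretation unif2: pair_prob_space "unif_on {0..1::real}" "unif_on {0..1::real}" ..

lemma unif_unit_pair:
  "unif_on {0..1::real} \<Otimes>\<^sub>M unif_on {0..1::real} = unif_on ({0..1} \<times> {0..1})"
proof -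
  have "unif_on {0..1::real} \<Otimes>\<^sub>M unif_on {0..1::real}
      = density (lborel \<Otimes>\<^sub>M lborel) (\<lambda>(x, y). indicator {0..1} x * indicator {0..1} y)"
    unfolding unif_on_def
    by (rule pair_measure_density)
      (use unif.sigma_finite_measure_axioms in \<open>auto simp: unif_on_def lborel.sigma_finite_measure_axioms\<close>)
  also have "(\<lambda>(x, y). indicator {0..1} x * indicator {0..1} y) = (indicator ({0..1} \<times> {0..1}) :: real \<times> real \<Rightarrow> ennreal)"
    by (auto simp: fun_eq_iff indicator_def)
  finally show ?thesis by (simp add: unif_on_def lborel_prod)
qed

lemma sets_unif_unit_pair: "sets (unif_on {0..1::real} \<Otimes>\<^sub>M unif_on {0..1::real}) = sets borel"
  by (simp only: unif_unit_pair sets_unif_on)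

lemma AE_unif_on_iff:
  assumes "S \<in> sets borel"
  shows "(AE x in unif_on S. P x) \<longleftrightarrow> (AE x in lborel. x \<in> S \<longrightarrow> P x)"
  unfolding unif_on_def using assms by (subst AE_density) (auto simp: indicator_def)

lemma AE_lebesgue_on_iff:
  assumes "S \<in> sets borel"
  shows "(AE x in lebesgue_on S. P x) \<longleftrightarrow> (AE x in unif_on S. P x)"
  using assms by (simp add: AE_unif_on_iff AE_restrict_space_iff AE_completion_iff)

lemma borel_measurable_lebesgue_on_borel:
  "h \<in> borel_measurable borel \<Longrightarrow> h \<in> borel_measurable (lebesgue_on S)"
  by (intro measurable_restrict_space1 measurable_completion) simp

lemma integral_lebesgue_on:
  fixes h :: "'a::euclidean_space \<Rightarrow> real"
  assumes S: "S \<in> sets borel" and h[measurable]: "h \<in> borel_measurable borel"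
  shows "(\<integral>x. h x \<partial>lebesgue_on S) = (\<integral>x. h x \<partial>unif_on S)"
proof -
  note S[measurable]
  have "(\<integral>x. h x \<partial>lebesgue_on S) = (\<integral>x. indicator S x *\<^sub>R h x \<partial>lebesgue)"
    by (rule integral_restrict_space) (use S in auto)
  also have "\<dots> = (\<integral>x. indicator S x *\<^sub>R h x \<partial>lborel)"
    by (rule integral_completion) measurable
  also have "\<dots> = (\<integral>x. h x \<partial>density lborel (\<lambda>x. ennreal (indicator S x)))"
    by (rule integral_density[symmetric]) auto
  finally show ?thesis by (simp add: unif_on_def ennreal_indicator)
qed

lemma borel_representative:
  fixes h :: "'a::euclidean_space \<Rightarrow> real"
  assumes S: "S \<in> sets borel" and h: "h \<in> borel_measurable (lebesgue_on S)"
    and bounds: "\<And>x. x \<in> S \<Longrightarrow> h x \<in> {0..1}"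
  obtains h' where "h' \<in> borel_measurable borel" "\<And>x. h' x \<in> {0..1}" "AE x in unif_on S. h x = h' x"
proof -
  have "(\<lambda>x. indicator S x *\<^sub>R h x) \<in> borel_measurable lebesgue"
    using h S by (subst (asm) borel_measurable_restrict_space_iff) auto
  then obtain k where k: "k \<in> borel_measurable lborel" "AE x in lborel. indicator S x *\<^sub>R h x = k x"
    by (metis completion_ex_borel_measurable_real)
  \<comment> \<open>Clamping changes nothing where \<open>k\<close> agrees with \<open>h\<close> on
    \<open>S\<close>, and makes the bounds hold at every point.\<close>
  show thesis
  proof (rule that[of "\<lambda>x. max 0 (min 1 (k x))"])
    show "(\<lambda>x. max 0 (min 1 (k x))) \<in> borel_measurable borel" using k(1) by simp
    show "AE x in unif_on S. h x = max 0 (min 1 (k x))"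
      unfolding AE_unif_on_iff[OF S] using k(2)
    proof eventually_elim
      case (elim x)
      show ?case using elim bounds[of x] by auto
    qed
  qed auto
qed

text \<open>This is completeness of Lebesgue measure: the preimages under \<open>h\<close> and
  \<open>h'\<close> within \<open>S\<close> differ by a subset of a null set.\<close>

lemma borel_measurable_lebesgue_on_AE:
  fixes h h' :: "'a::euclidean_space \<Rightarrow> real"
  assumes S: "S \<in> sets borel" and h': "h' \<in> borel_measurable borel"
    and ae: "AE x in unif_on S. h x = h' x"
  shows "h \<in> borel_measurable (lebesgue_on S)"
proof -
  note [measurable] = S h'
  have "(\<lambda>x. indicator S x *\<^sub>R h x) \<in> borel_measurable lebesgue"
  proof (rule measurableI)
    fix A :: "real set" assume A: "A \<in> sets borel"
    show "(\<lambda>x. indicator S x *\<^sub>R h x) -` A \<inter> space lebesgue \<in> sets lebesgue"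
    proof (rule completion.in_sets_AE)
      have "(\<lambda>x. indicator S x *\<^sub>R h' x) -` A \<inter> space borel \<in> sets borel"
        by (rule measurable_sets[OF _ A]) measurable
      then show "(\<lambda>x. indicator S x *\<^sub>R h' x) -` A \<in> sets lebesgue" by simp
      have "AE x in lebesgue. x \<in> S \<longrightarrow> h x = h' x"
        using ae S by (simp add: AE_unif_on_iff AE_completion_iff)
      then show "AE x in lebesgue. (x \<in> (\<lambda>x. indicator S x *\<^sub>R h' x) -` A)
          = (x \<in> (\<lambda>x. indicator S x *\<^sub>R h x) -` A \<inter> space lebesgue)"
        by eventually_elim (auto simp: indicator_def)
    qed simp
  qed simp
  then show ?thesis using S by (subst borel_measurable_restrict_space_iff) auto
qed

lemma integral_lebesgue_on_AE:
  fixes h h' :: "'a::euclidean_space \<Rightarrow> real"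
  assumes S: "S \<in> sets borel" and h': "h' \<in> borel_measurable borel"
    and ae: "AE x in unif_on S. h x = h' x"
  shows "(\<integral>x. h x \<partial>lebesgue_on S) = (\<integral>x. h' x \<partial>unif_on S)"
proof -
  have "(\<integral>x. h x \<partial>lebesgue_on S) = (\<integral>x. h' x \<partial>lebesgue_on S)"
    using ae unfolding AE_lebesgue_on_iff[OF S, symmetric]
    by (intro integral_cong_AE borel_measurable_lebesgue_on_AE[OF S h' ae]
        borel_measurable_lebesgue_on_borel h')
  also have "\<dots> = (\<integral>x. h' x \<partial>unif_on S)" by (rule integral_lebesgue_on[OF S h'])
  finally show ?thesis .
qed

lemma set_integral_unit:
  fixes f f' :: "real \<Rightarrow> real"
  assumes f': "f' \<in> borel_measurable borel" and ae: "AE x in unif_on {0..1}. f x = f' x"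
    and B: "B \<in> sets lebesgue" "B \<subseteq> {0..1}" and B': "B' \<in> sets borel" "AE x in unif_on {0..1}. x \<in> B \<longleftrightarrow> x \<in> B'"
  shows "(LINT x:B|lebesgue. f x) = (\<integral>x. indicator B' x * f' x \<partial>unif_on {0..1})"
    and "measure lebesgue B = unif.prob B'"
proof -
  have *: "(LINT x:B|lebesgue. h x) = (\<integral>x. indicator B x * h x \<partial>lebesgue_on {0..1})" for h :: "real \<Rightarrow> real"
    using B(2) by (subst integral_restrict_space)
      (auto simp: set_lebesgue_integral_def intro!: Bochner_Integration.integral_cong split: split_indicator)
  have **: "(LINT x:B|lebesgue. h x) = (\<integral>x. indicator B' x * h' x \<partial>unif_on {0..1})"
    if h': "h' \<in> borel_measurable borel" and "AE x in unif_on {0..1}. h x = h' x" for h h' :: "real \<Rightarrow> real"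
    unfolding * using that(2) B'
    by (intro integral_lebesgue_on_AE borel_measurable_times h') (auto elim!: AE_mp simp: indicator_def)
  show "(LINT x:B|lebesgue. f x) = (\<integral>x. indicator B' x * f' x \<partial>unif_on {0..1})"
    by (rule **[OF f' ae])
  have "measure lebesgue B = (LINT x:B|lebesgue. 1)"
    using B(1) by (simp add: set_lebesgue_integral_def)
  also have "\<dots> = (\<integral>x. indicator B' x * 1 \<partial>unif_on {0..1})"
    by (rule **) auto
  also have "\<dots> = unif.prob B'" using B'(1) by simp
  finally show "measure lebesgue B = unif.prob B'" .
qed

lemma borel_representative_set:
  assumes B: "B \<in> sets lebesgue"
  obtains B' :: "real set" where "B' \<in> sets borel" "AE x in unif_on {0..1}. x \<in> B \<longleftrightarrow> x \<in> B'"
proof -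
  obtain N where N: "N \<in> null_sets lborel" "null_part lborel B \<subseteq> N"
    using null_part[OF B] by blast
  have un: "main_part lborel B \<union> null_part lborel B = B"
    using B by (rule main_part_null_part_Un)
  show thesis
  proof (rule that[of "main_part lborel B"])
    show "main_part lborel B \<in> sets borel" using main_part_sets[OF B] by simp
    show "AE x in unif_on {0..1}. x \<in> B \<longleftrightarrow> x \<in> main_part lborel B"
      unfolding AE_unif_on_iff[OF borel_closed[OF closed_atLeastAtMost]] using AE_not_in[OF N(1)]
      by eventually_elim (use N(2) un in auto)
  qed
qed

text \<open>Condition I on an arbitrary probability space. Equality is imposed on the whole space
  only, since a set of full measure differs from it by a null set.\<close>

definition landau_condition :: "'a measure \<Rightarrow> ('a \<Rightarrow> real) \<Rightarrow> bool" where
  "landau_condition M f \<longleftrightarrow>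
     (\<forall>B\<in>sets M. (measure M B)\<^sup>2 / 2 \<le> (\<integral>x. indicator B x * f x \<partial>M)) \<and> (\<integral>x. f x \<partial>M) = 1 / 2"

lemma condition_I_iff_landau:
  assumes f'[measurable]: "f' \<in> borel_measurable borel" and ae: "AE x in unif_on {0..1}. f x = f' x"
  shows "condition_I f \<longleftrightarrow> landau_condition (unif_on {0..1}) f'"
proof
  assume I: "condition_I f"
  have 1: "(LINT x:B \<inter> {0..1}|lebesgue. f x) = (\<integral>x. indicator B x * f' x \<partial>unif_on {0..1})"
    and 2: "measure lebesgue (B \<inter> {0..1}) = unif.prob B" if B: "B \<in> sets borel" for B
  proof -
    have "B \<inter> {0..1} \<in> sets lebesgue" "B \<inter> {0..1} \<subseteq> {0..1}"
      "AE x in unif_on {0..1}. x \<in> B \<inter> {0..1} \<longleftrightarrow> x \<in> B"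
      using B by (auto simp: AE_unif_on_iff)
    note * = this(1,2) B this(3)
    show "(LINT x:B \<inter> {0..1}|lebesgue. f x) = (\<integral>x. indicator B x * f' x \<partial>unif_on {0..1})"
      by (rule set_integral_unit(1)[OF f' ae *])
    show "measure lebesgue (B \<inter> {0..1}) = unif.prob B"
      by (rule set_integral_unit(2)[OF f' ae *])
  qed
  show "landau_condition (unif_on {0..1}) f'"
    unfolding landau_condition_def
  proof (intro conjI ballI)
    fix B assume "B \<in> sets (unif_on {0..1::real})"
    then have B: "B \<in> sets borel" by simp
    then have "B \<inter> {0..1} \<in> sets lebesgue" "B \<inter> {0..1} \<subseteq> {0..1}" by auto
    then have "(LINT x:B \<inter> {0..1}|lebesgue. f x) \<ge> (measure lebesgue (B \<inter> {0..1}))\<^sup>2 / 2"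
      using I unfolding condition_I_def by blast
    then show "(unif.prob B)\<^sup>2 / 2 \<le> (\<integral>x. indicator B x * f' x \<partial>unif_on {0..1})"
      unfolding 1[OF B] 2[OF B] .
  next
    have "UNIV \<inter> {0..1::real} \<in> sets lebesgue" "UNIV \<inter> {0..1::real} \<subseteq> {0..1}" by auto
    moreover have "measure lebesgue (UNIV \<inter> {0..1::real}) = 1" by simp
    ultimately have "(LINT x:UNIV \<inter> {0..1}|lebesgue. f x) = (measure lebesgue (UNIV \<inter> {0..1::real}))\<^sup>2 / 2"
      using I unfolding condition_I_def by blast
    then show "(\<integral>x. f' x \<partial>unif_on {0..1}) = 1 / 2"
      using 1[of UNIV] by simp
  qed
next
  assume L: "landau_condition (unif_on {0..1}) f'"
  show "condition_I f"
    unfolding condition_I_def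
  proof (intro ballI impI conjI)
    fix B assume B: "B \<in> sets lebesgue" "B \<subseteq> {0..1::real}"
    obtain B' where B': "B' \<in> sets borel" "AE x in unif_on {0..1}. x \<in> B \<longleftrightarrow> x \<in> B'"
      using borel_representative_set[OF B(1)] by blast
    note eqs = set_integral_unit[OF f' ae B B']
    show "(measure lebesgue B)\<^sup>2 / 2 \<le> (LINT x:B|lebesgue. f x)"
      unfolding eqs using L B'(1) by (simp add: landau_condition_def)
    assume "measure lebesgue B = 1"
    then have "unif.prob B' = 1" using eqs by simp
    then have "AE x in unif_on {0..1}. x \<in> B'"
      using B'(1) by (subst unif.prob_eq_1[symmetric]) auto
    then have "(\<integral>x. indicator B' x * f' x \<partial>unif_on {0..1}) = (\<integral>x. f' x \<partial>unif_on {0..1})"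
      using B'(1) by (intro integral_cong_AE) (auto elim!: AE_mp)
    then show "(LINT x:B|lebesgue. f x) = (measure lebesgue B)\<^sup>2 / 2"
      unfolding eqs using L \<open>unif.prob B' = 1\<close> by (simp add: landau_condition_def)
  qed
qed

text \<open>Adding the integrals of \<open>W (x, y)\<close> and \<open>W (y, x)\<close> over
  \<open>B \<times> B\<close> gives the measure of the square, so each of them is half of it. The
  mass that the score on \<open>B\<close> has beyond this comes from pairs leading out of
  \<open>B\<close>: it is nonnegative, and there are no such pairs when \<open>B\<close> is the
  whole space.\<close>

lemma (in prob_space) landau_condition_score:
  assumes W: "W \<in> skew_kernels M"
  shows "landau_condition M (score M W)"
proof -
  interpret PP: pair_prob_space M M ..
  note [measurable] = skew_kernelsD(1)[OF W] score_measurable[OF W]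
  have sq: "(prob B)\<^sup>2 / 2 = (\<integral>x. (\<integral>y. indicator B x * indicator B y * W (x, y) \<partial>M) \<partial>M)"
    if B[measurable]: "B \<in> sets M" for B
  proof -
    have i: "integrable (M \<Otimes>\<^sub>M M) (\<lambda>(x, y). indicator B x * indicator B y * W (x, y))"
      by (rule PP.integrable_bounded_real[where c = 1])
        (use skew_kernelsD(2,3)[OF W] in \<open>auto simp: space_pair_measure indicator_def\<close>)
    have i': "integrable (M \<Otimes>\<^sub>M M) (\<lambda>(x, y). indicator B x * indicator B y * W (y, x))"
      by (rule PP.integrable_bounded_real[where c = 1])
        (use skew_kernelsD(2,3)[OF W] in \<open>auto simp: space_pair_measure indicator_def\<close>)
    have "(\<integral>x. (\<integral>y. indicator B x * indicator B y * W (x, y) \<partial>M) \<partial>M)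
        = (\<integral>x. (\<integral>y. indicator B x * indicator B y * W (y, x) \<partial>M) \<partial>M)"
      using PP.Fubini_integral[OF i'] by (simp add: mult.commute)
    then have "2 * (\<integral>x. (\<integral>y. indicator B x * indicator B y * W (x, y) \<partial>M) \<partial>M)
        = (\<integral>x. (\<integral>y. indicator B x * indicator B y * W (x, y) \<partial>M) \<partial>M)
        + (\<integral>x. (\<integral>y. indicator B x * indicator B y * W (y, x) \<partial>M) \<partial>M)" by simp
    also have "\<dots> = (\<integral>p. (case p of (x, y) \<Rightarrow> indicator B x * indicator B y * W (x, y)) \<partial>(M \<Otimes>\<^sub>M M))
        + (\<integral>p. (case p of (x, y) \<Rightarrow> indicator B x * indicator B y * W (y, x)) \<partial>(M \<Otimes>\<^sub>M M))"
      using PP.integral_fst[OF i] PP.integral_fst[OF i'] by simp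
    also have "\<dots> = (\<integral>p. (case p of (x, y) \<Rightarrow> indicator B x * indicator B y * W (x, y))
        + (case p of (x, y) \<Rightarrow> indicator B x * indicator B y * W (y, x)) \<partial>(M \<Otimes>\<^sub>M M))"
      by (rule Bochner_Integration.integral_add[OF i i', symmetric])
    also have "\<dots> = (\<integral>p. indicator (B \<times> B) p \<partial>(M \<Otimes>\<^sub>M M))"
    proof (intro Bochner_Integration.integral_cong refl)
      fix p assume "p \<in> space (M \<Otimes>\<^sub>M M)"
      then obtain x y where p: "p = (x, y)" "x \<in> space M" "y \<in> space M"
        by (auto simp: space_pair_measure)
      then show "(case p of (x, y) \<Rightarrow> indicator B x * indicator B y * W (x, y))
        + (case p of (x, y) \<Rightarrow> indicator B x * indicator B y * W (y, x)) = indicator (B \<times> B) p"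
        using skew_kernelsD(4)[OF W p(2,3)] by (cases "x \<in> B"; cases "y \<in> B") simp_all
    qed
    also have "\<dots> = measure (M \<Otimes>\<^sub>M M) (B \<times> B)" by simp
    also have "\<dots> = prob B * prob B" 
      by (simp add: measure_def emeasure_pair_measure_Times enn2real_mult)
    finally show ?thesis by (simp add: power2_eq_square)
  qed
  have inner: "(\<integral>y. indicator B x * indicator B y * W (x, y) \<partial>M) \<le> indicator B x * score M W x"
    if x: "x \<in> space M" and [measurable]: "B \<in> sets M" for x B
  proof -
    have "(\<integral>y. indicator B y * W (x, y) \<partial>M) \<le> score M W x" unfolding score_def
    proof (intro integral_mono kernel_section_integrable[OF W x])
      show "integrable M (\<lambda>y. indicator B y * W (x, y))"
        by (rule integrable_bounded_real[where c = 1])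
          (use skew_kernelsD(2,3)[OF W x] x in \<open>auto simp: indicator_def\<close>)
    qed (use skew_kernelsD(2)[OF W x] in \<open>auto simp: indicator_def\<close>)
    then show ?thesis by (auto simp: indicator_def mult.assoc)
  qed
  have lower: "(prob B)\<^sup>2 / 2 \<le> (\<integral>x. indicator B x * score M W x \<partial>M)" if B[measurable]: "B \<in> sets M" for B
    unfolding sq[OF B]
  proof (intro integral_mono inner B)
    have "integrable (M \<Otimes>\<^sub>M M) (\<lambda>(x, y). indicator B x * indicator B y * W (x, y))"
      by (rule PP.integrable_bounded_real[where c = 1])
        (use skew_kernelsD(2,3)[OF W] in \<open>auto simp: space_pair_measure indicator_def\<close>)
    then show "integrable M (\<lambda>x. \<integral>y. indicator B x * indicator B y * W (x, y) \<partial>M)"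
      by (rule PP.integrable_fst)
    show "integrable M (\<lambda>x. indicator B x * score M W x)"
      by (rule integrable_bounded_real[where c = 1])
        (use score_bounds[OF W] in \<open>auto simp: indicator_def\<close>)
  qed
  have "1 / 2 = (\<integral>x. (\<integral>y. indicator (space M) x * indicator (space M) y * W (x, y) \<partial>M) \<partial>M)"
    using sq[of "space M"] by (simp add: prob_space)
  also have "\<dots> = (\<integral>x. score M W x \<partial>M)"
    unfolding score_def by (intro Bochner_Integration.integral_cong refl) simp_all
  finally show ?thesis using lower by (simp add: landau_condition_def)
qed

lemma kernel_with_score_imp_landau:
  assumes W: "tournament_kernel W" and sc: "has_score_function W f"
    and f'[measurable]: "f' \<in> borel_measurable borel" and ae: "AE x in unif_on {0..1}. f x = f' x"
  shows "landau_condition (unif_on {0..1}) f'"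
proof -
  let ?U = "unif_on {0..1::real}" and ?Q = "{0..1::real} \<times> {0..1::real}"
  have Q: "?Q \<in> sets borel" and I: "{0..1::real} \<in> sets borel" by (simp_all add: borel_closed closed_Times)
  have "(\<lambda>(x, y). W x y) \<in> borel_measurable (lebesgue_on ?Q)"
    "\<And>p. p \<in> ?Q \<Longrightarrow> (case p of (x, y) \<Rightarrow> W x y) \<in> {0..1}"
    using W by (auto simp: tournament_kernel_def)
  from borel_representative[OF Q this] obtain V where
    Vm: "V \<in> borel_measurable borel" and V01: "\<And>p. V p \<in> {0..1}"
    and VW: "AE p in unif_on ?Q. (case p of (x, y) \<Rightarrow> W x y) = V p"
    by blast
  have [measurable]: "V \<in> borel_measurable (?U \<Otimes>\<^sub>M ?U)"
    using Vm unfolding measurable_cong_sets[OF sets_unif_unit_pair refl] .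
  have WV: "AE p in ?U \<Otimes>\<^sub>M ?U. W (fst p) (snd p) = V p"
    using VW unfolding unif_unit_pair by eventually_elim (auto split: prod.splits)
  have WV': "AE p in ?U \<Otimes>\<^sub>M ?U. W (snd p) (fst p) = V (snd p, fst p)"
    by (rule unif.AE_swap[OF WV, simplified])
  have skew: "AE p in ?U \<Otimes>\<^sub>M ?U. W (fst p) (snd p) + W (snd p) (fst p) = 1"
    using W unfolding tournament_kernel_def unif_unit_pair AE_lebesgue_on_iff[OF Q]
    by (auto simp: case_prod_unfold)
  \<comment> \<open>The Borel version \<open>V\<close> of \<open>W\<close> is skew only almost
    everywhere. The set of exceptional pairs is symmetric, so resetting the value to 1/2 there
    yields a kernel that is skew everywhere.\<close>
  define V' where "V' = (\<lambda>(x, y). if V (x, y) + V (y, x) = 1 then V (x, y) else 1 / 2)"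
  have V': "V' \<in> skew_kernels ?U"
  proof -
    have "V' \<in> borel_measurable (?U \<Otimes>\<^sub>M ?U)" unfolding V'_def by measurable
    then show ?thesis using V01 by (auto simp: skew_kernels_def V'_def add.commute)
  qed
  have "AE p in ?U \<Otimes>\<^sub>M ?U. W (fst p) (snd p) = V' p"
    using WV WV' skew by eventually_elim (auto simp: V'_def)
  then have "AE x in ?U. AE y in ?U. W x y = V' (x, y)"
    using unif2.AE_pair by fastforce
  \<comment> \<open>The identity with the score of \<open>V'\<close> can be expected only for almost
    every \<open>x\<close>, namely where the section of \<open>W\<close> agrees with that of
    \<open>V'\<close> almost everywhere. That suffices, as \<open>landau_condition\<close> only sees
    integrals.\<close>
  moreover have "AE x in ?U. x \<in> {0..1}" by (simp add: AE_unif_on_iff[OF I])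
  ultimately have "AE x in ?U. f x = score ?U V' x"
  proof eventually_elim
    case (elim x)
    have "f x = (\<integral>y. W x y \<partial>lebesgue_on {0..1})"
      using sc elim(2) has_bochner_integral_integral_eq[of "lebesgue_on {0..1}" "W x" "f x"]
      by (simp add: has_score_function_def)
    also have "\<dots> = score ?U V' x" unfolding score_def
    proof (rule integral_lebesgue_on_AE[OF I _ elim(1)])
      show "(\<lambda>y. V' (x, y)) \<in> borel_measurable borel"
        using measurable_Pair2[OF skew_kernelsD(1)[OF V'], of x] by simp
    qed
    finally show ?case .
  qed
  with ae have *: "AE x in ?U. f' x = score ?U V' x" by eventually_elim simp
  note [measurable] = unif.score_measurable[OF V']
  have "(\<integral>x. f' x \<partial>?U) = (\<integral>x. score ?U V' x \<partial>?U)"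
    by (rule integral_cong_AE) (use * in auto)
  moreover have "(\<integral>x. indicator B x * f' x \<partial>?U) = (\<integral>x. indicator B x * score ?U V' x \<partial>?U)"
    if "B \<in> sets borel" for B
    by (rule integral_cong_AE) (use * that in auto)
  ultimately show ?thesis
    using unif.landau_condition_score[OF V'] by (simp add: landau_condition_def)
qed

lemma landau_imp_kernel_with_score:
  assumes L: "landau_condition (unif_on {0..1}) f'"
    and f'[measurable]: "f' \<in> borel_measurable borel" and f'01: "\<And>x. f' x \<in> {0..1}"
    and ae: "AE x in unif_on {0..1}. f x = f' x" and f01: "\<And>x. x \<in> {0..1} \<Longrightarrow> f x \<in> {0..1}"
  shows "\<exists>W. tournament_kernel W \<and> has_score_function W f"
proof -
  let ?U = "unif_on {0..1::real}" and ?Q = "{0..1::real} \<times> {0..1::real}"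
  have Q: "?Q \<in> sets borel" and I: "{0..1::real} \<in> sets borel" by (simp_all add: borel_closed closed_Times)
  obtain V where V: "V \<in> skew_kernels ?U" and sc: "AE x in ?U. score ?U V x = f' x"
    using unif.skew_kernel_with_score[of f'] L f' f'01 unfolding landau_condition_def by auto
  have Vm: "V \<in> borel_measurable borel"
    using skew_kernelsD(1)[OF V] unfolding measurable_cong_sets[OF sets_unif_unit_pair refl] .
  have Vx: "(\<lambda>y. V (x, y)) \<in> borel_measurable borel" for x
    using measurable_Pair2[OF skew_kernelsD(1)[OF V], of x] by simp
  \<comment> \<open>On the exceptional null set the whole row is replaced by the constant
    \<open>f x\<close>, whose integral is \<open>f x\<close>. This spoils skewness only at pairs
    with a coordinate in \<open>Z\<close>, a null set of the square. As \<open>Z\<close> need not be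
    Borel, measurability of \<open>W\<close> comes from completeness.\<close>
  define Z where "Z = {x. score ?U V x \<noteq> f x}"
  have Z: "AE x in ?U. x \<notin> Z" using sc ae by eventually_elim (simp add: Z_def)
  define W where "W x y = (if x \<in> Z then f x else V (x, y))" for x y
  have "AE p in ?U \<Otimes>\<^sub>M ?U. fst p \<notin> Z" "AE p in ?U \<Otimes>\<^sub>M ?U. snd p \<notin> Z"
    using unif.AE_fst[OF Z] unif.AE_swap[OF unif.AE_fst[OF Z]] by simp_all
  then have Z2: "AE p in unif_on ?Q. fst p \<notin> Z \<and> snd p \<notin> Z"
    unfolding unif_unit_pair by eventually_elim simp
  have "tournament_kernel W"
    unfolding tournament_kernel_def
  proof (intro conjI)
    show "(\<lambda>(x, y). W x y) \<in> borel_measurable (lebesgue_on ?Q)"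
      by (rule borel_measurable_lebesgue_on_AE[OF Q Vm]) (use Z2 in eventually_elim, auto simp: W_def)
    show "\<forall>x\<in>{0..1}. \<forall>y\<in>{0..1}. W x y \<in> {0..1}"
      using f01 skew_kernelsD(2,3)[OF V] by (auto simp: W_def)
    show "AE (x, y) in lebesgue_on ?Q. W x y + W y x = 1"
      unfolding AE_lebesgue_on_iff[OF Q] using Z2
      by eventually_elim (use skew_kernelsD(4)[OF V] in \<open>auto simp: W_def\<close>)
  qed
  moreover have "has_score_function W f"
    unfolding has_score_function_def
  proof
    fix x :: real assume x: "x \<in> {0..1}"
    have int: "integrable (lebesgue_on {0..1}) (W x)"
    proof (rule finite_measure.integrable_const_bound[where B = 1])
      show "finite_measure (lebesgue_on {0..1::real})"
        by (rule finite_measureI) (simp add: space_restrict_space emeasure_restrict_space)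
      show "W x \<in> borel_measurable (lebesgue_on {0..1})"
        unfolding W_def using borel_measurable_lebesgue_on_borel[OF Vx[of x]] by auto
      show "AE y in lebesgue_on {0..1}. norm (W x y) \<le> 1"
        using f01[OF x] skew_kernelsD(2,3)[OF V] by (intro AE_I2) (auto simp: W_def)
    qed
    have "(\<integral>y. W x y \<partial>lebesgue_on {0..1}) = f x"
    proof (cases "x \<in> Z")
      case True
      then show ?thesis by (simp add: W_def measure_restrict_space)
    next
      case False
      then have "(\<integral>y. W x y \<partial>lebesgue_on {0..1}) = score ?U V x"
        by (simp add: W_def score_def integral_lebesgue_on[OF I Vx])
      with False show ?thesis by (simp add: Z_def)
    qed
    with int show "has_bochner_integral (lebesgue_on {0..1}) (W x) (f x)"
      by (simp add: has_bochner_integral_iff)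
  qed
  ultimately show ?thesis by blast
qed

section \<open>Scores of finite tournaments\<close>

context prob_space
begin

text \<open>The hinge integral lives on \<open>B = {f < c}\<close>. If \<open>b\<close> is the
  measure of \<open>B\<close>, it is at most \<open>c * b - b^2 / 2\<close>, which is largest for
  \<open>b = c\<close>. This and \<open>hinge_imp_lower\<close> are the two directions of a Legendre
  duality between the set form and the hinge form of the condition.\<close>

lemma landau_imp_hinge:
  assumes f[measurable]: "f \<in> borel_measurable M" and f01: "\<And>x. x \<in> space M \<Longrightarrow> f x \<in> {0..1}"
    and L: "landau_condition M f"
  shows "(\<integral>x. max 0 (c - f x) \<partial>M) \<le> c\<^sup>2 / 2"
proof -
  define B where "B = {x \<in> space M. f x < c}"
  have B[measurable]: "B \<in> sets M" unfolding B_def by measurable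
  have i: "integrable M (\<lambda>x. indicator B x * f x)"
    by (rule integrable_bounded_real[where c = 1]) (use f01 in \<open>auto simp: indicator_def\<close>)
  have j: "integrable M (\<lambda>x. c * indicator B x)"
    by (rule integrable_bounded_real[where c = "\<bar>c\<bar>"]) (auto simp: indicator_def)
  have "(\<integral>x. max 0 (c - f x) \<partial>M) = (\<integral>x. c * indicator B x - indicator B x * f x \<partial>M)"
    by (intro Bochner_Integration.integral_cong refl) (auto simp: B_def indicator_def)
  also have "\<dots> = c * prob B - (\<integral>x. indicator B x * f x \<partial>M)"
    unfolding Bochner_Integration.integral_diff[OF j i] by simp
  also have "\<dots> \<le> c * prob B - (prob B)\<^sup>2 / 2"
    using L B by (auto simp: landau_condition_def)
  also have "\<dots> = c\<^sup>2 / 2 - (c - prob B)\<^sup>2 / 2"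
    by (simp add: power2_eq_square field_simps)
  also have "\<dots> \<le> c\<^sup>2 / 2" by simp
  finally show ?thesis .
qed

text \<open>Taking \<open>c\<close> to be the measure of \<open>B\<close> is optimal: since
  \<open>c - f\<close> is at most its positive part, \<open>c^2\<close> minus the mass of
  \<open>f\<close> on \<open>B\<close> is at most \<open>c^2 / 2 + \<eta>\<close>.\<close>

lemma hinge_imp_lower:
  assumes f[measurable]: "f \<in> borel_measurable M" and f01: "\<And>x. x \<in> space M \<Longrightarrow> f x \<in> {0..1}"
    and hinge: "\<And>c. c \<in> {0..1} \<Longrightarrow> (\<integral>x. max 0 (c - f x) \<partial>M) \<le> c\<^sup>2 / 2 + \<eta>"
    and B[measurable]: "B \<in> sets M"
  shows "(prob B)\<^sup>2 / 2 - \<eta> \<le> (\<integral>x. indicator B x * f x \<partial>M)"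
proof -
  define c where "c = prob B"
  have c: "c \<in> {0..1}" by (simp add: c_def)
  have i: "integrable M (\<lambda>x. indicator B x * f x)"
    by (rule integrable_bounded_real[where c = 1]) (use f01 in \<open>auto simp: indicator_def\<close>)
  have j: "integrable M (\<lambda>x. c * indicator B x)"
    by (rule integrable_bounded_real[where c = "\<bar>c\<bar>"]) (auto simp: indicator_def)
  have "c * prob B - (\<integral>x. indicator B x * f x \<partial>M) = (\<integral>x. c * indicator B x - indicator B x * f x \<partial>M)"
    unfolding Bochner_Integration.integral_diff[OF j i] by simp
  also have "\<dots> \<le> (\<integral>x. max 0 (c - f x) \<partial>M)"
  proof (intro integral_mono)
    show "integrable M (\<lambda>x. max 0 (c - f x))"
      by (rule integrable_bounded_real[where c = 1]) (use f01 c in \<open>force simp: abs_le_iff\<close>)+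
    show "integrable M (\<lambda>x. c * indicator B x - indicator B x * f x)"
      by (rule Bochner_Integration.integrable_diff[OF j i])
  qed (auto simp: indicator_def)
  also have "\<dots> \<le> c\<^sup>2 / 2 + \<eta>" by (rule hinge[OF c])
  finally show ?thesis by (simp add: c_def power2_eq_square)
qed

end

section \<open>Degrees and homomorphism densities of finite tournaments\<close>

definition outdegree :: "'a pair_pre_digraph \<Rightarrow> 'a \<Rightarrow> nat" where
  "outdegree G v = card {w. (v, w) \<in> parcs G}"

definition indegree :: "'a pair_pre_digraph \<Rightarrow> 'a \<Rightarrow> nat" where
  "indegree G v = card {w. (w, v) \<in> parcs G}"

text \<open>Normalised by N instead of N - 1, to match the denominators of homomorphism densities;
  the price is corrections of order 1/N in the tournament identities below.\<close>

definition score_of :: "'a pair_pre_digraph \<Rightarrow> 'a \<Rightarrow> real" where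
  "score_of G v = real (outdegree G v) / real (card (pverts G))"

lemma pair_digraph_S_digraph: "pair_digraph (S_digraph m n)"
  by unfold_locales (auto simp: S_digraph_def)

lemma pair_digraphD:
  assumes "pair_digraph G"
  shows "finite (pverts G)" "finite (parcs G)" "parcs G \<subseteq> pverts G \<times> pverts G"
    and "(u, v) \<in> parcs G \<Longrightarrow> u \<noteq> v"
proof -
  interpret pair_digraph G by fact
  show "finite (pverts G)" "finite (parcs G)"
    by (fact pair_finite_verts pair_finite_arcs)+
  show "parcs G \<subseteq> pverts G \<times> pverts G" using wellformed' by auto
  show "(u, v) \<in> parcs G \<Longrightarrow> u \<noteq> v" using pair_no_loops[of "(u, v)"] by simp
qed

text \<open>Homomorphisms are sorted by the image \<open>v\<close> of the middle vertex. The
  remaining vertices are then mapped independently, \<open>m\<close> of them to in-neighbours and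
  \<open>n\<close> of them to out-neighbours of \<open>v\<close>, so the density is a mixed moment
  of the degrees of a random vertex.\<close>

lemma hom_density_S_digraph:
  assumes G: "pair_digraph G"
  shows "hom_density (S_digraph m n) G = (\<Sum>v\<in>pverts G. (real (indegree G v) / card (pverts G)) ^ m
    * score_of G v ^ n) / card (pverts G)"
proof -
  note fin = pair_digraphD(1)[OF G] and sub = pair_digraphD(3)[OF G]
  have finN: "finite {w. (v, w) \<in> parcs G}" "finite {w. (w, v) \<in> parcs G}" for v
    by (rule finite_subset[OF _ fin]; use sub in auto)+
  define H where "H v = (\<Pi>\<^sub>E i\<in>{..m+n}. if i < m then {w. (w, v) \<in> parcs G}
    else if i = m then {v} else {w. (v, w) \<in> parcs G})" for v
  have homs: "digraph_homs (S_digraph m n) G = (\<Union>v\<in>pverts G. H v)"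
  proof (intro equalityI subsetI)
    fix \<phi> assume \<phi>: "\<phi> \<in> digraph_homs (S_digraph m n) G"
    have ext: "\<phi> \<in> {..m + n} \<rightarrow>\<^sub>E pverts G"
      and arcs: "\<And>i j. (i, j) \<in> ({..<m} \<times> {m}) \<union> ({m} \<times> {m<..m + n}) \<Longrightarrow> (\<phi> i, \<phi> j) \<in> parcs G"
      using \<phi> by (auto simp: digraph_homs_def S_digraph_def)
    have lt: "(\<phi> i, \<phi> m) \<in> parcs G" if "i < m" for i using arcs[of i m] that by simp
    have gt: "(\<phi> m, \<phi> i) \<in> parcs G" if "m < i" "i \<le> m + n" for i using arcs[of m i] that by simp
    have "\<phi> m \<in> pverts G" using PiE_mem[OF ext, of m] by simp
    moreover have "\<phi> \<in> H (\<phi> m)"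
      unfolding H_def by (rule PiE_I) (use lt gt PiE_arb[OF ext] in auto)
    ultimately show "\<phi> \<in> (\<Union>v\<in>pverts G. H v)" by blast
  next
    fix \<phi> assume "\<phi> \<in> (\<Union>v\<in>pverts G. H v)"
    then obtain v where v: "v \<in> pverts G" "\<phi> \<in> H v" by blast
    have val: "\<phi> i \<in> (if i < m then {w. (w, v) \<in> parcs G}
        else if i = m then {v} else {w. (v, w) \<in> parcs G})" if "i \<le> m + n" for i
      using PiE_mem[OF v(2)[unfolded H_def], of i] that by simp
    have lt: "(\<phi> i, v) \<in> parcs G" if "i < m" for i using val[of i] that by simp
    have eq: "\<phi> m = v" using val[of m] by simp
    have gt: "(v, \<phi> i) \<in> parcs G" if "m < i" "i \<le> m + n" for i using val[of i] that by simp
    have "\<phi> i \<in> pverts G" if "i \<le> m + n" for i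
      using lt[of i] eq gt[of i] that v(1) sub by (cases i m rule: linorder_cases) auto
    moreover have "\<phi> \<in> extensional {..m+n}" using v(2) by (auto simp: H_def PiE_def)
    ultimately show "\<phi> \<in> digraph_homs (S_digraph m n) G"
      using lt eq gt by (auto simp: digraph_homs_def S_digraph_def PiE_iff)
  qed
  have "card (digraph_homs (S_digraph m n) G) = (\<Sum>v\<in>pverts G. card (H v))"
    unfolding homs
  proof (rule card_UN_disjoint[OF fin])
    show "\<forall>v\<in>pverts G. finite (H v)"
      unfolding H_def using finN by (auto intro!: finite_PiE)
    have "\<phi> m = v" if "\<phi> \<in> H v" for \<phi> v using PiE_mem[OF that[unfolded H_def], of m] by simp
    then show "\<forall>v\<in>pverts G. \<forall>w\<in>pverts G. v \<noteq> w \<longrightarrow> H v \<inter> H w = {}" by blast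
  qed
  moreover have "card (H v) = indegree G v ^ m * outdegree G v ^ n" for v
  proof -
    have split: "{..m+n} = {..<m} \<union> {m} \<union> {m<..m+n}" by auto
    have "card (H v) = (\<Prod>i\<in>{..m+n}. if i < m then indegree G v else if i = m then 1 else outdegree G v)"
      unfolding H_def
      by (subst card_PiE) (auto intro!: prod.cong simp: indegree_def outdegree_def)
    also have "\<dots> = indegree G v ^ m * outdegree G v ^ n"
      unfolding split by (subst prod.union_disjoint, auto)+
    finally show ?thesis .
  qed
  ultimately have "real (card (digraph_homs (S_digraph m n) G))
      = (\<Sum>v\<in>pverts G. real (indegree G v) ^ m * real (outdegree G v) ^ n)" by simp
  moreover have "card (pverts (S_digraph m n)) = m + n + 1" by (simp add: S_digraph_def)
  ultimately show ?thesis
    unfolding hom_density_def score_of_def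
    by (simp add: sum_divide_distrib power_divide power_add field_simps)
qed

lemma sum_outdegree:
  assumes G: "pair_digraph G" and B: "B \<subseteq> pverts G"
  shows "(\<Sum>v\<in>B. h v * real (outdegree G v)) = (\<Sum>(v, w)\<in>{a \<in> parcs G. fst a \<in> B}. h v)"
proof -
  note fin = pair_digraphD(1)[OF G] and sub = pair_digraphD(3)[OF G]
  have finN: "finite {w. (v, w) \<in> parcs G}" for v
    by (rule finite_subset[OF _ fin]) (use sub in auto)
  have eq: "{a \<in> parcs G. fst a \<in> B} = (SIGMA v:B. {w. (v, w) \<in> parcs G})" by auto
  have "(\<Sum>(v, w)\<in>{a \<in> parcs G. fst a \<in> B}. h v) = (\<Sum>v\<in>B. \<Sum>w\<in>{w. (v, w) \<in> parcs G}. h v)"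
    unfolding eq by (rule sum.Sigma[symmetric]) (use finite_subset[OF B fin] finN in auto)
  also have "\<dots> = (\<Sum>v\<in>B. h v * real (outdegree G v))" by (simp add: outdegree_def mult.commute)
  finally show ?thesis ..
qed

text \<open>Each pair of distinct vertices carries exactly one of the two possible arcs.\<close>

lemma tournament_sum_symmetric:
  fixes k :: "'a \<Rightarrow> 'a \<Rightarrow> real"
  assumes G: "tournament G" and B: "B \<subseteq> pverts G" and sym: "\<And>u v. k u v = k v u"
  shows "2 * (\<Sum>(u, v)\<in>parcs G \<inter> B \<times> B. k u v) = (\<Sum>u\<in>B. \<Sum>v\<in>B. k u v) - (\<Sum>u\<in>B. k u u)"
proof -
  have dig: "pair_digraph G" using G by (simp add: tournament_def)
  note fin = pair_digraphD(1,2)[OF dig] and sub = pair_digraphD(3)[OF dig]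
  have finB: "finite B" by (rule finite_subset[OF B fin(1)])
  let ?A = "parcs G \<inter> B \<times> B" and ?D = "(\<lambda>u. (u, u)) ` B"
  have tour: "((u, v) \<in> parcs G) \<noteq> ((v, u) \<in> parcs G)" if "u \<in> B" "v \<in> B" "u \<noteq> v" for u v
    using G B that unfolding tournament_def by blast
  have "(\<Sum>(u, v)\<in>?A\<inverse>. k u v) = (\<Sum>(u, v)\<in>?A. k u v)"
    by (rule sum.reindex_bij_witness[of _ prod.swap prod.swap]) (auto simp: sym)
  then have "2 * (\<Sum>(u, v)\<in>?A. k u v) = (\<Sum>(u, v)\<in>?A. k u v) + (\<Sum>(u, v)\<in>?A\<inverse>. k u v)" by simp
  also have "\<dots> = (\<Sum>(u, v)\<in>?A \<union> ?A\<inverse>. k u v)"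
    using fin(2) tour pair_digraphD(4)[OF dig] by (subst sum.union_disjoint) auto
  also have "?A \<union> ?A\<inverse> = B \<times> B - ?D"
    using tour pair_digraphD(4)[OF dig] by auto
  also have "(\<Sum>(u, v)\<in>B \<times> B - ?D. k u v) = (\<Sum>(u, v)\<in>B \<times> B. k u v) - (\<Sum>(u, v)\<in>?D. k u v)"
    using finB by (intro sum_diff) auto
  also have "(\<Sum>(u, v)\<in>?D. k u v) = (\<Sum>u\<in>B. k u u)"
    by (subst sum.reindex) (auto simp: inj_on_def)
  also have "(\<Sum>(u, v)\<in>B \<times> B. k u v) = (\<Sum>u\<in>B. \<Sum>v\<in>B. k u v)"
    by (simp add: sum.cartesian_product)
  finally show ?thesis .
qed

lemma tournament_indegree:
  assumes G: "tournament G" and v: "v \<in> pverts G"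
  shows "indegree G v + outdegree G v + 1 = card (pverts G)"
proof -
  have dig: "pair_digraph G" using G by (simp add: tournament_def)
  note fin = pair_digraphD(1)[OF dig] and sub = pair_digraphD(3)[OF dig]
  let ?I = "{w. (w, v) \<in> parcs G}" and ?O = "{w. (v, w) \<in> parcs G}"
  have tour: "((u, w) \<in> parcs G) \<noteq> ((w, u) \<in> parcs G)" if "u \<in> pverts G" "w \<in> pverts G" "u \<noteq> w" for u w
    using G that unfolding tournament_def by blast
  have finN: "finite ?I" "finite ?O" by (rule finite_subset[OF _ fin]; use sub in auto)+
  have disj: "?I \<inter> ?O = {}" "v \<notin> ?I \<union> ?O"
    using tour sub pair_digraphD(4)[OF dig] by blast+
  have "pverts G = insert v (?I \<union> ?O)"
    using tour[OF v] v sub by auto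
  then have "card (pverts G) = Suc (card (?I \<union> ?O))"
    using finN disj(2) by (metis card_insert_disjoint finite_UnI)
  also have "card (?I \<union> ?O) = card ?I + card ?O" by (rule card_Un_disjoint[OF finN disj(1)])
  finally show ?thesis by (simp add: indegree_def outdegree_def)
qed

lemma score_of_bounds:
  assumes G: "tournament G" and v: "v \<in> pverts G"
  shows "0 \<le> score_of G v" "score_of G v \<le> 1"
  using tournament_indegree[OF assms] by (auto simp: score_of_def divide_le_eq)

text \<open>The easy half of Landau's theorem: the \<open>b\<close> vertices with score below
  \<open>c\<close> already have b(b-1)/2 arcs among themselves, which bounds their total outdegree
  from below. The optimisation over \<open>b\<close> is that of \<open>landau_imp_hinge\<close>; the
  missing loops cost the term 1/(2n).\<close>

lemma tournament_hinge:
  assumes G: "tournament G" and N: "pverts G \<noteq> {}"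
  shows "(\<Sum>v\<in>pverts G. max 0 (c - score_of G v)) / card (pverts G)
    \<le> c\<^sup>2 / 2 + 1 / (2 * card (pverts G))"
proof -
  have dig: "pair_digraph G" using G by (simp add: tournament_def)
  note fin = pair_digraphD(1,2)[OF dig] and sub = pair_digraphD(3)[OF dig]
  define n where "n = real (card (pverts G))"
  have n: "0 < n" using N fin by (simp add: n_def card_gt_0_iff)
  define B where "B = {v \<in> pverts G. score_of G v < c}"
  define b where "b = real (card B)"
  have B: "B \<subseteq> pverts G" by (auto simp: B_def)
  have finB: "finite B" by (rule finite_subset[OF B fin(1)])
  have b: "0 \<le> b" "b \<le> n" using card_mono[OF fin(1) B] by (auto simp: b_def n_def)
  have "b * b - b = 2 * (\<Sum>(u, v)\<in>parcs G \<inter> B \<times> B. 1)"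
    by (subst tournament_sum_symmetric[OF G B]) (simp_all add: b_def)
  also have "\<dots> \<le> 2 * (\<Sum>(u, v)\<in>{a \<in> parcs G. fst a \<in> B}. 1)"
    using fin(2) by (intro mult_left_mono sum_mono2) auto
  also have "\<dots> = 2 * (\<Sum>v\<in>B. real (outdegree G v))"
    using sum_outdegree[OF dig B, of "\<lambda>_. 1"] by simp
  also have "(\<Sum>v\<in>B. real (outdegree G v)) = n * (\<Sum>v\<in>B. score_of G v)"
    using n by (simp add: sum_distrib_left score_of_def n_def)
  finally have out: "(b * b - b) / (2 * n) \<le> (\<Sum>v\<in>B. score_of G v)"
    using n by (simp add: field_simps)
  have "(\<Sum>v\<in>pverts G. max 0 (c - score_of G v)) = (\<Sum>v\<in>B. c - score_of G v)"
    using fin(1) by (intro sum.mono_neutral_cong_right) (auto simp: B_def)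
  also have "\<dots> = c * b - (\<Sum>v\<in>B. score_of G v)"
    by (simp add: sum_subtractf b_def)
  also have "\<dots> \<le> c * b - (b * b - b) / (2 * n)" using out by simp
  also have "\<dots> \<le> n * (c\<^sup>2 / 2 + 1 / (2 * n))"
  \<comment> \<open>Completing the square: after clearing denominators the difference of the two
    sides is (cn - b)^2 plus the surplus n - b of the loop terms.\<close>
  proof -
    have "0 \<le> (c * n - b)\<^sup>2 + (n - b)" using b by simp
    then have "2 * n * c * b - b * b + b \<le> n * n * c * c + n"
      by (simp add: power2_eq_square algebra_simps)
    then have "(2 * n * c * b - b * b + b) / (2 * n) \<le> (n * n * c * c + n) / (2 * n)"
      using n by (intro divide_right_mono) auto
    moreover have "c * b - (b * b - b) / (2 * n) = (2 * n * c * b - b * b + b) / (2 * n)"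
      "n * (c\<^sup>2 / 2 + 1 / (2 * n)) = (n * n * c * c + n) / (2 * n)"
      using n by (simp_all add: field_simps power2_eq_square)
    ultimately show ?thesis by simp
  qed
  finally have "(\<Sum>v\<in>pverts G. max 0 (c - score_of G v)) / n \<le> c\<^sup>2 / 2 + 1 / (2 * n)"
    using n by (simp add: divide_le_eq mult.commute)
  then show ?thesis by (simp add: n_def)
qed

section \<open>Tournaments with nearly prescribed scores\<close>

lemma uniform_count_measure_prob:
  assumes "finite A" "A \<noteq> {}"
  shows "prob_space (uniform_count_measure A)"
  by (rule prob_spaceI)
    (use assms in \<open>simp add: emeasure_uniform_count_measure space_uniform_count_measure\<close>)

lemma borel_measurable_uniform_count_measure: "h \<in> borel_measurable (uniform_count_measure A)"
  by (simp add: measurable_def sets_uniform_count_measure space_uniform_count_measure)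

lemma abs_average_le_sqrt:
  fixes e :: "'a \<Rightarrow> real"
  assumes A: "finite A" "A \<noteq> {}" and e: "\<And>v. v \<in> A \<Longrightarrow> \<bar>e v\<bar> \<le> 1"
  shows "(\<Sum>v\<in>A. \<bar>e v\<bar>) / card A \<le> sqrt ((\<Sum>v\<in>A. (e v)\<^sup>2) / card A)"
proof -
  interpret prob_space "uniform_count_measure A" by (rule uniform_count_measure_prob[OF A])
  have "((\<Sum>v\<in>A. \<bar>e v\<bar>) / card A)\<^sup>2 \<le> (\<Sum>v\<in>A. (e v)\<^sup>2) / card A"
    using expectation_abs_square_le[of e] e A(1)
    by (simp add: borel_measurable_uniform_count_measure space_uniform_count_measure
        integral_uniform_count_measure)
  then show ?thesis by (rule real_le_rsqrt)
qed

definition flip_arc :: "'a pair_pre_digraph \<Rightarrow> 'a \<Rightarrow> 'a \<Rightarrow> 'a pair_pre_digraph" where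
  "flip_arc G u v = \<lparr>pverts = pverts G, parcs = insert (v, u) (parcs G - {(u, v)})\<rparr>"

lemma tournament_flip_arc:
  assumes G: "tournament G" and uv: "(u, v) \<in> parcs G"
  shows "tournament (flip_arc G u v)"
proof -
  have dig: "pair_digraph G" using G by (simp add: tournament_def)
  note D = pair_digraphD[OF dig]
  have no_loop: "(w, w) \<notin> parcs G" for w using D(4) by blast
  have "pair_digraph (flip_arc G u v)"
    by unfold_locales (use D(1-3) no_loop uv in \<open>auto simp: flip_arc_def\<close>)
  moreover have "((x, y) \<in> parcs (flip_arc G u v)) \<noteq> ((y, x) \<in> parcs (flip_arc G u v))"
    if xy: "x \<in> pverts G" "y \<in> pverts G" "x \<noteq> y" for x y
  proof -
    have "((x, y) \<in> parcs G) \<noteq> ((y, x) \<in> parcs G)"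
      using G xy unfolding tournament_def by blast
    moreover have "parcs (flip_arc G u v) = insert (v, u) (parcs G - {(u, v)})"
      by (simp add: flip_arc_def)
    ultimately show ?thesis using uv D(4)[OF uv] by (cases "x = u \<and> y = v"; cases "x = v \<and> y = u") auto
  qed
  moreover have "pverts (flip_arc G u v) = pverts G" by (simp add: flip_arc_def)
  ultimately show ?thesis unfolding tournament_def by blast
qed

lemma outdegree_flip_arc:
  assumes G: "tournament G" and uv: "(u, v) \<in> parcs G"
  shows "real (outdegree (flip_arc G u v) u) = real (outdegree G u) - 1"
    and "real (outdegree (flip_arc G u v) v) = real (outdegree G v) + 1"
    and "w \<noteq> u \<Longrightarrow> w \<noteq> v \<Longrightarrow> outdegree (flip_arc G u v) w = outdegree G w"
proof -
  have dig: "pair_digraph G" using G by (simp add: tournament_def)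
  note D = pair_digraphD[OF dig]
  have finN: "finite {w. (x, w) \<in> parcs G}" for x
    by (rule finite_subset[OF _ D(1)]) (use D(3) in auto)
  have uv': "u \<in> pverts G" "v \<in> pverts G" "u \<noteq> v" using D(3) D(4)[OF uv] uv by auto
  then have vu: "(v, u) \<notin> parcs G" using G uv unfolding tournament_def by blast
  have "{w. (u, w) \<in> parcs (flip_arc G u v)} = {w. (u, w) \<in> parcs G} - {v}"
    using uv' by (auto simp: flip_arc_def)
  moreover have "0 < card {w. (u, w) \<in> parcs G}" using uv finN by (auto simp: card_gt_0_iff)
  ultimately show "real (outdegree (flip_arc G u v) u) = real (outdegree G u) - 1"
    using uv by (simp add: outdegree_def of_nat_diff)
  have "{w. (v, w) \<in> parcs (flip_arc G u v)} = insert u {w. (v, w) \<in> parcs G}"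
    using uv' by (auto simp: flip_arc_def)
  then show "real (outdegree (flip_arc G u v) v) = real (outdegree G v) + 1"
    using vu finN by (simp add: outdegree_def)
  show "outdegree (flip_arc G u v) w = outdegree G w" if "w \<noteq> u" "w \<noteq> v"
    using that by (simp add: outdegree_def flip_arc_def)
qed

text \<open>
  A finite analogue of the descent step for kernels: a tournament whose scores are as close as
  possible to \<open>a\<close> cannot be improved by reversing an arc, hence orients (almost) every pair towards
  the vertex with the smaller excess \<open>e\<close>.
\<close>

lemma tournament_near_scores:
  fixes a :: "nat \<Rightarrow> real" and \<eta> :: real
  assumes N: "0 < N" and a01: "\<And>v. v < N \<Longrightarrow> a v \<in> {0..1}"
    and hinge: "\<And>c. c \<in> {0..1} \<Longrightarrow> (\<Sum>v<N. max 0 (c - a v)) / N \<le> c\<^sup>2 / 2 + \<eta>"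
    and total: "(\<Sum>v<N. a v) / N \<le> 1 / 2 + \<eta>"
  obtains G :: "nat pair_pre_digraph" where "tournament G" "pverts G = {..<N}"
    and "(\<Sum>v<N. (score_of G v - a v)\<^sup>2) / N \<le> 3 * \<eta> + 1 / N"
proof -
  let ?V = "{..<N}"
  define T where "T = {G :: nat pair_pre_digraph. tournament G \<and> pverts G = ?V}"
  define F where "F G = (\<Sum>v<N. (score_of G v - a v)\<^sup>2)" for G
  have "finite T"
  proof -
    have "T \<subseteq> (\<lambda>A. \<lparr>pverts = ?V, parcs = A\<rparr>) ` Pow (?V \<times> ?V)"
    proof
      fix G assume "G \<in> T"
      then have "pverts G = ?V" "parcs G \<subseteq> ?V \<times> ?V"
        using pair_digraphD(3)[of G] by (auto simp: T_def tournament_def)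
      then show "G \<in> (\<lambda>A. \<lparr>pverts = ?V, parcs = A\<rparr>) ` Pow (?V \<times> ?V)"
        by (intro image_eqI[of _ _ "parcs G"]) auto
    qed
    then show ?thesis by (rule finite_subset) simp
  qed
  moreover have "T \<noteq> {}"
  proof -
    let ?G = "\<lparr>pverts = ?V, parcs = {(u, v). u < v \<and> v < N}\<rparr>"
    have "finite {(u, v). u < v \<and> v < N}"
      by (rule finite_subset[of _ "?V \<times> ?V"]) auto
    then have "pair_digraph ?G" by unfold_locales auto
    then have "?G \<in> T" by (auto simp: T_def tournament_def)
    then show ?thesis by blast
  qed
  ultimately obtain G where GT: "G \<in> T" and min: "\<And>G'. G' \<in> T \<Longrightarrow> F G \<le> F G'"
    using ex_min_if_finite[of "F ` T"] by (metis arg_min_if_finite(1) arg_min_least)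
  have G: "tournament G" "pverts G = ?V" using GT by (auto simp: T_def)
  have dig: "pair_digraph G" using G by (simp add: tournament_def)
  note D = pair_digraphD[OF dig]
  define e where "e v = score_of G v - a v" for v
  have e1: "\<bar>e v\<bar> \<le> 1" if "v < N" for v
  proof -
    have v: "v \<in> pverts G" using that G(2) by simp
    show ?thesis using score_of_bounds[OF G(1) v] a01[OF that] by (simp add: e_def abs_le_iff)
  qed
  \<comment> \<open>Reversing an arc from \<open>u\<close> to \<open>v\<close> lowers the score of
    \<open>u\<close> and raises that of \<open>v\<close> by d = 1/N, so the objective changes by
    2d(e v - e u + d). At a minimum this is nonnegative, whence e u \<le> e v + 1/N.\<close>
  have arc: "e u \<le> min (e u) (e v) + 1 / N" if uv: "(u, v) \<in> parcs G" for u v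
  proof -
    let ?G = "flip_arc G u v"
    define d where "d = 1 / real N"
    have uv': "u < N" "v < N" "u \<noteq> v" using D(3) D(4)[OF uv] uv G(2) by auto
    have "?G \<in> T" using tournament_flip_arc[OF G(1) uv] G(2) by (simp add: T_def flip_arc_def)
    then have "F G \<le> F ?G" by (rule min)
    have sc: "score_of ?G u = score_of G u - 1 / N" "score_of ?G v = score_of G v + 1 / N"
      "\<And>w. w \<noteq> u \<Longrightarrow> w \<noteq> v \<Longrightarrow> score_of ?G w = score_of G w"
      using outdegree_flip_arc[OF G(1) uv] G(2)
      by (simp_all add: score_of_def flip_arc_def diff_divide_distrib add_divide_distrib)
    have V: "?V = insert u (insert v (?V - {u, v}))" using uv' by auto
    have split: "(\<Sum>w<N. h w) = h u + h v + (\<Sum>w\<in>?V - {u, v}. h w)" for h :: "nat \<Rightarrow> real"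
      by (subst V) (use uv' in \<open>simp add: add.assoc\<close>)
    have "(\<Sum>w\<in>?V - {u, v}. (score_of ?G w - a w)\<^sup>2) = (\<Sum>w\<in>?V - {u, v}. (score_of G w - a w)\<^sup>2)"
      by (intro sum.cong refl) (use sc(3) in auto)
    with \<open>F G \<le> F ?G\<close> have "(e u)\<^sup>2 + (e v)\<^sup>2 \<le> (e u - d)\<^sup>2 + (e v + d)\<^sup>2"
      unfolding F_def split sc(1,2) e_def d_def by (simp add: algebra_simps)
    then have "(e u - e v) * (2 * d) \<le> d * (2 * d)"
      by (simp add: power2_eq_square algebra_simps)
    moreover have "0 < d" using N by (simp add: d_def)
    ultimately have "e u - e v \<le> d" by (simp add: mult_le_cancel_right)
    then have "e u - e v \<le> 1 / N" by (simp add: d_def)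
    then show ?thesis by (simp add: min_def)
  qed
  have arcs: "parcs G \<inter> ?V \<times> ?V = parcs G" "{a \<in> parcs G. fst a \<in> ?V} = parcs G"
    using D(3) G(2) by auto
  have "2 * real (card (parcs G)) = 2 * (\<Sum>(u, v)\<in>parcs G \<inter> ?V \<times> ?V. 1)"
    unfolding arcs by simp
  also have "\<dots> = real N * real N - real N"
    by (subst tournament_sum_symmetric[OF G(1)]) (use G(2) in auto)
  finally have card_arcs: "2 * real (card (parcs G)) \<le> real N * real N" by simp
  \<comment> \<open>Counting arcs by their tails turns this sum into a sum of \<open>e\<close> over
    tails. Each tail is, up to 1/N, the endpoint with the smaller excess, so the correlation of
    \<open>e\<close> with the scores is nearly the least possible one.\<close>
  have "real N * (\<Sum>v<N. e v * score_of G v) = (\<Sum>v<N. e v * real (outdegree G v))"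
    using N G(2) by (simp add: sum_distrib_left score_of_def)
  also have "\<dots> = (\<Sum>(u, v)\<in>parcs G. e u)"
    using sum_outdegree[OF dig, of ?V e] G(2) unfolding arcs by simp
  also have "\<dots> \<le> (\<Sum>(u, v)\<in>parcs G. min (e u) (e v) + 1 / N)"
    using arc by (intro sum_mono) auto
  also have "\<dots> = (\<Sum>(u, v)\<in>parcs G. min (e u) (e v)) + card (parcs G) / N"
    by (simp add: sum.distrib case_prod_unfold)
  finally have up1: "real N * (\<Sum>v<N. e v * score_of G v)
      \<le> (\<Sum>(u, v)\<in>parcs G. min (e u) (e v)) + card (parcs G) / N" .
  have up2: "card (parcs G) / N \<le> N / 2"
    using card_arcs N by (simp add: field_simps)
  have "(\<Sum>(u, v)\<in>parcs G. min (e u) (e v)) = (\<Sum>(u, v)\<in>parcs G \<inter> ?V \<times> ?V. min (e u) (e v))"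
    unfolding arcs ..
  also have "\<dots> = ((\<Sum>u<N. \<Sum>v<N. min (e u) (e v)) - (\<Sum>u<N. e u)) / 2"
    using tournament_sum_symmetric[OF G(1), of ?V "\<lambda>u v. min (e u) (e v)"] G(2)
    by (simp add: min.commute)
  finally have up3: "(\<Sum>(u, v)\<in>parcs G. min (e u) (e v))
      = ((\<Sum>u<N. \<Sum>v<N. min (e u) (e v)) - (\<Sum>u<N. e u)) / 2" .
  have "(\<Sum>u<N. - e u) \<le> (\<Sum>u<N. 1)"
    by (intro sum_mono) (use e1 in \<open>force simp: abs_le_iff\<close>)
  then have up4: "- (\<Sum>u<N. e u) \<le> N" by (simp add: sum_negf)
  \<comment> \<open>Two errors of at most n/2 each are collected: \<open>c\<close> is the slack 1/N
    summed over the arcs, and -t/2 comes from the absent diagonal. Division by N^2 turns the total n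
    into the term 1/N of the conclusion.\<close>
  have arith: "A \<le> S + c \<Longrightarrow> c \<le> n / 2 \<Longrightarrow> S = (m - t) / 2 \<Longrightarrow> - t \<le> n \<Longrightarrow> A \<le> m / 2 + n"
    for A S c m n t :: real by (simp add: field_simps)
  have up: "real N * (\<Sum>v<N. e v * score_of G v) \<le> (\<Sum>u<N. \<Sum>v<N. min (e u) (e v)) / 2 + N"
    by (rule arith[OF up1 up2 up3 up4])
  let ?M = "uniform_count_measure ?V"
  interpret prob_space ?M by (rule uniform_count_measure_prob) (use N in auto)
  \<comment> \<open>The layer-cake inequality for the uniform distribution on the vertices, with
    \<open>e\<close> in the role of \<open>g\<close> and the targets \<open>a\<close> in the role of
    \<open>f\<close>.\<close>
  have low: "(\<Sum>u<N. \<Sum>v<N. min (e u) (e v)) / N / N / 2 - 3 * \<eta> \<le> (\<Sum>v<N. e v * a v) / N"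
  proof -
    have "(\<integral>x. (\<integral>y. min (e x) (e y) \<partial>?M) \<partial>?M) / 2 - 3 * \<eta> \<le> (\<integral>x. e x * a x \<partial>?M)"
    proof (rule layer_cake_min)
      show "(prob B)\<^sup>2 / 2 - \<eta> \<le> (\<integral>x. indicator B x * a x \<partial>?M)" if "B \<in> sets ?M" for B
        by (rule hinge_imp_lower[OF _ _ _ that])
          (use a01 hinge in \<open>auto simp: borel_measurable_uniform_count_measure
            space_uniform_count_measure integral_uniform_count_measure\<close>)
    qed (use a01 e1 total in \<open>auto simp: borel_measurable_uniform_count_measure
            space_uniform_count_measure integral_uniform_count_measure\<close>)
    then show ?thesis by (simp add: integral_uniform_count_measure sum_divide_distrib)
  qed
  \<comment> \<open>The correlation of \<open>e\<close> with the scores is bounded above, and that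
    with the targets below, by the same mean of minima. It cancels in the difference, leaving only
    error terms.\<close>
  have "(\<Sum>v<N. (e v)\<^sup>2) = (\<Sum>v<N. e v * score_of G v) - (\<Sum>v<N. e v * a v)"
    unfolding sum_subtractf[symmetric]
    by (intro sum.cong) (auto simp: e_def power2_eq_square algebra_simps)
  moreover have "(\<Sum>v<N. e v * score_of G v) / N \<le> (\<Sum>u<N. \<Sum>v<N. min (e u) (e v)) / N / N / 2 + 1 / N"
    using up N by (simp add: field_simps)
  ultimately have "(\<Sum>v<N. (e v)\<^sup>2) / N \<le> 3 * \<eta> + 1 / N"
    using low by (simp add: diff_divide_distrib)
  then show thesis using that[OF G] by (simp add: e_def)
qed

section \<open>Tournament limits\<close>

text \<open>The points are the quantiles at (v+1)/N. On the v-th interval of length 1/N, replacing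
  the quantile function by its right endpoint value costs at most L times its increment. By
  monotonicity the increments telescope to 1, so the rate L/N needs no regularity of the
  law.\<close>

lemma (in prob_space) equidistributed_points:
  fixes f :: "'a \<Rightarrow> real"
  assumes f[measurable]: "f \<in> borel_measurable M" and f01: "\<And>x. x \<in> space M \<Longrightarrow> f x \<in> {0..1}"
    and N: "0 < (N::nat)"
  obtains a :: "nat \<Rightarrow> real" where "\<And>v. a v \<in> {0..1}"
    and "\<And>\<phi> L. \<phi> \<in> borel_measurable borel \<Longrightarrow>
      (\<And>x y. x \<in> {0..1} \<Longrightarrow> y \<in> {0..1} \<Longrightarrow> \<bar>\<phi> x - \<phi> y\<bar> \<le> L * \<bar>x - y\<bar>) \<Longrightarrow>
      \<bar>(\<Sum>v<N. \<phi> (a v)) / N - (\<integral>x. \<phi> (f x) \<partial>M)\<bar> \<le> L / N"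
proof -
  define \<mu> where "\<mu> = distr M borel f"
  interpret \<mu>: cdf_distribution \<mu>
    unfolding cdf_distribution_def \<mu>_def by (rule real_distribution_distr) fact
  have C: "\<mu>.C x = prob {y \<in> space M. f y \<le> x}" for x
    unfolding cdf_def \<mu>_def by (subst measure_distr) (auto intro!: arg_cong[where f = prob])
  \<comment> \<open>The pseudoinverse satisfies \<open>\<mu>.I t \<le> x\<close> iff
    \<open>t \<le> \<mu>.C x\<close>. All mass lies below 1, which gives the upper bound; the mass
    up to \<open>\<mu>.I t\<close> is at least t > 0, so some value of \<open>f\<close>, which is
    nonnegative, lies below \<open>\<mu>.I t\<close>.\<close>
  have I01: "0 \<le> \<mu>.I t" "\<mu>.I t \<le> 1" if t: "0 < t" "t < 1" for t
  proof -
    have "{y \<in> space M. f y \<le> 1} = space M" using f01 by auto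
    then show "\<mu>.I t \<le> 1" using t \<mu>.pseudoinverse[OF t, of 1] by (simp add: C prob_space)
    have "t \<le> \<mu>.C (\<mu>.I t)" using \<mu>.pseudoinverse[OF t, of "\<mu>.I t"] by simp
    then have "0 < prob {y \<in> space M. f y \<le> \<mu>.I t}" using t(1) C[of "\<mu>.I t"] by linarith
    then have "{y \<in> space M. f y \<le> \<mu>.I t} \<noteq> {}" by (metis less_irrefl measure_empty)
    then show "0 \<le> \<mu>.I t" using f01 by force
  qed
  \<comment> \<open>The extension by 0 and 1 outside the open interval keeps the quantile function
    monotone and fixes its end values, so that the total increment over [0,1] is exactly 1.\<close>
  define Q where "Q t = (if t \<le> 0 then 0 else if 1 \<le> t then 1 else \<mu>.I t)" for t
  have Q01: "0 \<le> Q t" "Q t \<le> 1" for t by (auto simp: Q_def I01)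
  have Q_mono: "Q s \<le> Q t" if "s \<le> t" for s t
    using that Q01(1)[of t] Q01(2)[of s] mono_onD[OF \<mu>.mono_I, of s t] by (auto simp: Q_def I01)
  have [measurable]: "Q \<in> borel_measurable borel"
    by (intro borel_measurable_mono monoI) (rule Q_mono)
  define p where "p v = real v / N" for v
  have p: "p 0 = 0" "p N = 1" "\<And>v. p (Suc v) - p v = 1 / N" "\<And>v. p v \<le> p (Suc v)" "\<And>v. 0 \<le> p v"
    using N by (auto simp: p_def field_simps)
  show thesis
  proof (rule that[of "\<lambda>v. Q (p (Suc v))"])
    show "Q (p (Suc v)) \<in> {0..1}" for v using Q01 by auto
    fix \<phi> :: "real \<Rightarrow> real" and L :: real
    assume [measurable]: "\<phi> \<in> borel_measurable borel"
      and lip: "\<And>x y. x \<in> {0..1} \<Longrightarrow> y \<in> {0..1} \<Longrightarrow> \<bar>\<phi> x - \<phi> y\<bar> \<le> L * \<bar>x - y\<bar>"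
    have L: "0 \<le> L" using lip[of 0 1] by auto
    have bound: "\<bar>\<phi> (Q t)\<bar> \<le> \<bar>\<phi> 0\<bar> + L" for t
    proof -
      have "\<bar>\<phi> (Q t) - \<phi> 0\<bar> \<le> L * \<bar>Q t - 0\<bar>" using Q01 by (intro lip) auto
      also have "\<dots> \<le> L * 1" using Q01[of t] L by (intro mult_left_mono) auto
      finally show ?thesis by linarith
    qed
    define J where "J v = {p v<..p (Suc v)}" for v
    have Jm[measurable]: "J v \<in> sets borel" for v by (simp add: J_def)
    have J_meas: "measure lborel (J v) = 1 / N" "emeasure lborel (J v) < \<infinity>" for v
      using p(3,4)[of v] by (simp_all add: J_def)
    have int: "integrable lborel (\<lambda>t. indicator (J v) t * \<phi> (Q t))" for v
    proof (rule Bochner_Integration.integrable_bound)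
      show "integrable lborel (\<lambda>t. (\<bar>\<phi> 0\<bar> + L) * indicator (J v) t)"
        using J_meas(2) by simp
    qed (use bound L in \<open>auto simp: indicator_def intro!: AE_I2 order_trans[OF bound]\<close>)
    have int': "integrable lborel (\<lambda>t. indicator (J v) t * c)" for v and c :: real
      using J_meas(2) by simp
    have ind: "(\<Sum>v<n. indicator (J v) t) = (indicator {0<..p n} t :: real)" for n t
    proof (induction n)
      case (Suc n)
      then show ?case using p(4,5)[of n] by (auto simp: J_def indicator_def)
    qed (simp add: p(1))
    have "(\<integral>x. \<phi> (f x) \<partial>M) = (\<integral>x. \<phi> x \<partial>\<mu>)"
      unfolding \<mu>_def by (rule integral_distr[symmetric]) measurable
    also have "\<dots> = (\<integral>t. \<phi> (\<mu>.I t) \<partial>restrict_space lborel {0<..<1})"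
      by (subst \<mu>.distr_I_eq_M[symmetric], subst integral_distr) (auto simp: \<mu>.measurable_CI cong: measurable_cong_sets)
    also have "\<dots> = (\<integral>t. indicator {0<..<1} t *\<^sub>R \<phi> (\<mu>.I t) \<partial>lborel)"
      by (rule integral_restrict_space) simp
    also have "\<dots> = (\<integral>t. indicator {0<..<1} t * \<phi> (Q t) \<partial>lborel)"
      by (intro Bochner_Integration.integral_cong) (auto simp: Q_def indicator_def)
    also have "\<dots> = (\<integral>t. indicator {0<..1} t * \<phi> (Q t) \<partial>lborel)"
      using AE_lborel_singleton[of 1] by (intro integral_cong_AE) (auto simp: indicator_def)
    also have "\<dots> = (\<integral>t. (\<Sum>v<N. indicator (J v) t * \<phi> (Q t)) \<partial>lborel)"
      by (simp add: sum_distrib_right[symmetric] ind p(2))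
    also have "\<dots> = (\<Sum>v<N. \<integral>t. indicator (J v) t * \<phi> (Q t) \<partial>lborel)"
      by (intro Bochner_Integration.integral_sum int)
    finally have E: "(\<integral>x. \<phi> (f x) \<partial>M) = (\<Sum>v<N. \<integral>t. indicator (J v) t * \<phi> (Q t) \<partial>lborel)" .
    have piece: "\<bar>\<phi> (Q (p (Suc v))) / N - (\<integral>t. indicator (J v) t * \<phi> (Q t) \<partial>lborel)\<bar>
        \<le> L * (Q (p (Suc v)) - Q (p v)) / N" for v
    proof -
      have "\<phi> (Q (p (Suc v))) / N - (\<integral>t. indicator (J v) t * \<phi> (Q t) \<partial>lborel)
          = (\<integral>t. indicator (J v) t * \<phi> (Q (p (Suc v))) - indicator (J v) t * \<phi> (Q t) \<partial>lborel)"
        unfolding Bochner_Integration.integral_diff[OF int' int] by (simp add: J_meas(1))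
      also have "\<bar>\<dots>\<bar> \<le> (\<integral>t. indicator (J v) t * (L * (Q (p (Suc v)) - Q (p v))) \<partial>lborel)"
      proof (rule integral_abs_bound_integral)
        show "integrable lborel (\<lambda>t. indicator (J v) t * \<phi> (Q (p (Suc v))) - indicator (J v) t * \<phi> (Q t))"
          by (rule Bochner_Integration.integrable_diff[OF int' int])
        fix t
        have "\<bar>\<phi> (Q (p (Suc v))) - \<phi> (Q t)\<bar> \<le> L * (Q (p (Suc v)) - Q (p v))" if "t \<in> J v"
        proof -
          have "Q (p v) \<le> Q t" "Q t \<le> Q (p (Suc v))" using that by (auto simp: J_def intro!: Q_mono)
          then have "L * \<bar>Q (p (Suc v)) - Q t\<bar> \<le> L * (Q (p (Suc v)) - Q (p v))"
            using L by (intro mult_left_mono) auto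
          moreover have "\<bar>\<phi> (Q (p (Suc v))) - \<phi> (Q t)\<bar> \<le> L * \<bar>Q (p (Suc v)) - Q t\<bar>"
            using Q01 by (intro lip) auto
          ultimately show ?thesis by linarith
        qed
        then show "\<bar>indicator (J v) t * \<phi> (Q (p (Suc v))) - indicator (J v) t * \<phi> (Q t)\<bar>
            \<le> indicator (J v) t * (L * (Q (p (Suc v)) - Q (p v)))"
          by (auto simp: indicator_def)
      qed (rule int')
      finally show ?thesis by (simp add: J_meas(1))
    qed
    have "\<bar>(\<Sum>v<N. \<phi> (Q (p (Suc v)))) / N - (\<integral>x. \<phi> (f x) \<partial>M)\<bar>
        = \<bar>\<Sum>v<N. \<phi> (Q (p (Suc v))) / N - (\<integral>t. indicator (J v) t * \<phi> (Q t) \<partial>lborel)\<bar>"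
      unfolding E by (simp add: sum_subtractf sum_divide_distrib)
    also have "\<dots> \<le> (\<Sum>v<N. L * (Q (p (Suc v)) - Q (p v)) / N)"
      by (intro order_trans[OF sum_abs] sum_mono piece)
    also have "\<dots> = L * (\<Sum>v<N. Q (p (Suc v)) - Q (p v)) / N"
      by (simp add: sum_distrib_left sum_divide_distrib)
    also have "(\<Sum>v<N. Q (p (Suc v)) - Q (p v)) = 1"
      unfolding sum_lessThan_telescope[of "\<lambda>v. Q (p v)"] p(1,2) by (simp add: Q_def)
    finally show "\<bar>(\<Sum>v<N. \<phi> (Q (p (Suc v)))) / N - (\<integral>x. \<phi> (f x) \<partial>M)\<bar> \<le> L / N" by simp
  qed
qed

text \<open>Empty or infinite \<open>V n\<close> are harmless: both sides of every estimate are then \<open>0\<close>.\<close>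

lemma (in prob_space) moments_imp_expectation_limit:
  fixes f :: "'a \<Rightarrow> real" and x :: "nat \<Rightarrow> 'b \<Rightarrow> real" and V :: "nat \<Rightarrow> 'b set"
  assumes f[measurable]: "f \<in> borel_measurable M" and f01: "\<And>y. y \<in> space M \<Longrightarrow> f y \<in> {0..1}"
    and x01: "\<And>n v. v \<in> V n \<Longrightarrow> x n v \<in> {0..1}"
    and moments: "\<And>m. (\<lambda>n. (\<Sum>v\<in>V n. x n v ^ m) / card (V n)) \<longlonglongrightarrow> (\<integral>y. f y ^ m \<partial>M)"
    and \<phi>: "continuous_on UNIV \<phi>"
  shows "(\<lambda>n. (\<Sum>v\<in>V n. \<phi> (x n v)) / card (V n)) \<longlonglongrightarrow> (\<integral>y. \<phi> (f y) \<partial>M)"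
proof (rule LIMSEQ_I)
  fix \<epsilon> :: real assume "0 < \<epsilon>"
  then have \<epsilon>: "0 < \<epsilon> / 3" by simp
  obtain g where g: "real_polynomial_function g" "\<And>y. y \<in> {0..1} \<Longrightarrow> \<bar>\<phi> y - g y\<bar> < \<epsilon> / 3"
    by (rule Stone_Weierstrass_real_polynomial_function[OF compact_Icc[of 0 1] continuous_on_subset[OF \<phi> subset_UNIV] \<epsilon>])
      blast
  obtain a d where a: "g = (\<lambda>y. \<Sum>i\<le>d. a i * y ^ i)"
    using g(1) real_polynomial_function_iff_sum by blast
  have gc: "continuous_on UNIV g" unfolding a by (intro continuous_intros)
  note [measurable] = borel_measurable_continuous_onI[OF \<phi>] borel_measurable_continuous_onI[OF gc]
  have pow_int: "integrable M (\<lambda>y. f y ^ i)" for i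
    by (rule integrable_bounded_real[where c = 1]) (use f01 in \<open>auto simp: power_le_one\<close>)
  have int_bounded: "integrable M (\<lambda>y. h (f y))" if h: "continuous_on UNIV h" for h :: "real \<Rightarrow> real"
  proof -
    have "compact (h ` {0..1})"
      by (rule compact_continuous_image[OF continuous_on_subset[OF h]]) auto
    then have "bounded (h ` {0..1})" by (rule compact_imp_bounded)
    then obtain K where K: "\<And>y. y \<in> {0..1} \<Longrightarrow> \<bar>h y\<bar> \<le> K"
      unfolding bounded_iff real_norm_def by blast
    note [measurable] = borel_measurable_continuous_onI[OF h]
    show ?thesis by (rule integrable_bounded_real[where c = K]) (use K f01 in auto)
  qed
  have avg: "(\<lambda>n. (\<Sum>v\<in>V n. g (x n v)) / card (V n)) = (\<lambda>n. \<Sum>i\<le>d. a i * ((\<Sum>v\<in>V n. x n v ^ i) / card (V n)))"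
    unfolding a sum_divide_distrib sum_distrib_left by (subst sum.swap) simp
  have mean: "(\<integral>y. g (f y) \<partial>M) = (\<Sum>i\<le>d. a i * (\<integral>y. f y ^ i \<partial>M))"
    unfolding a by (subst Bochner_Integration.integral_sum) (auto intro: pow_int)
  have "(\<lambda>n. (\<Sum>v\<in>V n. g (x n v)) / card (V n)) \<longlonglongrightarrow> (\<integral>y. g (f y) \<partial>M)"
    unfolding avg mean by (intro tendsto_sum tendsto_mult tendsto_const moments)
  from LIMSEQ_D[OF this \<epsilon>] obtain n0 where n0: "\<And>n. n0 \<le> n \<Longrightarrow>
      \<bar>(\<Sum>v\<in>V n. g (x n v)) / card (V n) - (\<integral>y. g (f y) \<partial>M)\<bar> < \<epsilon> / 3"
    unfolding real_norm_def by blast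
  have 1: "\<bar>(\<Sum>v\<in>V n. \<phi> (x n v)) / card (V n) - (\<Sum>v\<in>V n. g (x n v)) / card (V n)\<bar> \<le> \<epsilon> / 3" for n
  proof -
    have "\<bar>(\<Sum>v\<in>V n. \<phi> (x n v)) - (\<Sum>v\<in>V n. g (x n v))\<bar> \<le> (\<Sum>v\<in>V n. \<bar>\<phi> (x n v) - g (x n v)\<bar>)"
      unfolding sum_subtractf[symmetric] by (rule sum_abs)
    also have "\<dots> \<le> (\<Sum>v\<in>V n. \<epsilon> / 3)"
      by (intro sum_mono less_imp_le g(2) x01)
    finally have "\<bar>(\<Sum>v\<in>V n. \<phi> (x n v)) - (\<Sum>v\<in>V n. g (x n v))\<bar> \<le> card (V n) * (\<epsilon> / 3)" by simp
    then have "\<bar>(\<Sum>v\<in>V n. \<phi> (x n v)) - (\<Sum>v\<in>V n. g (x n v))\<bar> / card (V n) \<le> \<epsilon> / 3"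
      using \<open>0 < \<epsilon>\<close> by (cases "card (V n) = 0") (simp_all add: divide_le_eq mult.commute)
    then show ?thesis by (simp flip: diff_divide_distrib)
  qed
  have 2: "\<bar>(\<integral>y. g (f y) \<partial>M) - (\<integral>y. \<phi> (f y) \<partial>M)\<bar> \<le> \<epsilon> / 3"
  proof -
    have "\<bar>(\<integral>y. g (f y) \<partial>M) - (\<integral>y. \<phi> (f y) \<partial>M)\<bar> = \<bar>\<integral>y. g (f y) - \<phi> (f y) \<partial>M\<bar>"
      by (subst Bochner_Integration.integral_diff[OF int_bounded[OF gc] int_bounded[OF \<phi>]]) simp
    also have "\<dots> \<le> (\<integral>y. \<bar>g (f y) - \<phi> (f y)\<bar> \<partial>M)" by (rule integral_abs_bound)
    also have "\<dots> \<le> (\<integral>y. \<epsilon> / 3 \<partial>M)"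
    proof (rule integral_mono)
      show "integrable M (\<lambda>y. \<bar>g (f y) - \<phi> (f y)\<bar>)"
        by (intro integrable_abs Bochner_Integration.integrable_diff int_bounded gc \<phi>)
      show "\<bar>g (f y) - \<phi> (f y)\<bar> \<le> \<epsilon> / 3" if "y \<in> space M" for y
        using g(2)[OF f01[OF that]] by linarith
    qed simp
    finally show ?thesis by (simp add: prob_space)
  qed
  show "\<exists>n0. \<forall>n\<ge>n0. norm ((\<Sum>v\<in>V n. \<phi> (x n v)) / card (V n) - (\<integral>y. \<phi> (f y) \<partial>M)) < \<epsilon>"
  proof (intro exI allI impI)
    fix n assume "n0 \<le> n"
    from n0[OF this] 1[of n] 2 show "norm ((\<Sum>v\<in>V n. \<phi> (x n v)) / card (V n) - (\<integral>y. \<phi> (f y) \<partial>M)) < \<epsilon>"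
      unfolding real_norm_def by linarith
  qed
qed

lemma tournament_mean_score:
  assumes G: "tournament G" and N: "pverts G \<noteq> {}"
  shows "(\<Sum>v\<in>pverts G. score_of G v) / card (pverts G) = 1 / 2 - 1 / (2 * card (pverts G))"
proof -
  have dig: "pair_digraph G" using G by (simp add: tournament_def)
  note D = pair_digraphD[OF dig]
  define n where "n = real (card (pverts G))"
  have n: "0 < n" using N D(1) by (simp add: n_def card_gt_0_iff)
  have arcs: "parcs G \<inter> pverts G \<times> pverts G = parcs G" "{a \<in> parcs G. fst a \<in> pverts G} = parcs G"
    using D(3) by auto
  have "2 * (\<Sum>(u, v)\<in>parcs G. 1) = n * n - n"
    using tournament_sum_symmetric[OF G order_refl, of "\<lambda>_ _. 1"] unfolding arcs by (simp add: n_def)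
  moreover have "(\<Sum>(u, v)\<in>parcs G. 1) = (\<Sum>v\<in>pverts G. real (outdegree G v))"
    using sum_outdegree[OF dig order_refl, of "\<lambda>_. 1"] unfolding arcs by simp
  moreover have "\<dots> = n * (\<Sum>v\<in>pverts G. score_of G v)"
    using n by (simp add: sum_distrib_left score_of_def n_def)
  ultimately have "2 * (n * (\<Sum>v\<in>pverts G. score_of G v)) = n * n - n" by simp
  then have "n * (2 * (\<Sum>v\<in>pverts G. score_of G v)) = n * (n - 1)" by (simp add: algebra_simps)
  then have "2 * (\<Sum>v\<in>pverts G. score_of G v) = n - 1" using n by simp
  then have "(\<Sum>v\<in>pverts G. score_of G v) / n = 1 / 2 - 1 / (2 * n)"
    using n by (simp add: field_simps)
  then show ?thesis by (simp add: n_def)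
qed

lemma distr_lebesgue_on_eq:
  assumes f: "f \<in> borel_measurable (lebesgue_on {0..1})" and f': "f' \<in> borel_measurable borel"
    and ae: "AE x in unif_on {0..1::real}. f x = (f' x :: real)"
  shows "distr (lebesgue_on {0..1}) borel f = distr (unif_on {0..1}) borel f'"
proof -
  have "distr (lebesgue_on {0..1}) borel f = distr (lebesgue_on {0..1}) borel f'"
    by (rule distr_cong_AE[OF refl refl _ f borel_measurable_lebesgue_on_borel[OF f']])
      (use ae in \<open>simp add: AE_lebesgue_on_iff\<close>)
  also have "\<dots> = distr (unif_on {0..1}) borel f'"
  proof (rule measure_eqI)
    fix A assume "A \<in> sets (distr (lebesgue_on {0..1}) borel f')"
    then have A: "A \<in> sets borel" by simp
    have P: "f' -` A \<in> sets borel" using measurable_sets[OF f' A] by simp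
    have "emeasure (distr (lebesgue_on {0..1}) borel f') A = emeasure (lebesgue_on {0..1}) (f' -` A \<inter> {0..1})"
      using borel_measurable_lebesgue_on_borel[OF f'] A by (subst emeasure_distr) (auto simp: space_restrict_space)
    also have "\<dots> = emeasure lborel (f' -` A \<inter> {0..1})"
      using P by (subst emeasure_restrict_space) auto
    also have "\<dots> = (\<integral>\<^sup>+x. indicator (f' -` A \<inter> {0..1}) x \<partial>lborel)"
      using P by (intro nn_integral_indicator[symmetric]) auto
    also have "\<dots> = (\<integral>\<^sup>+x. indicator {0..1} x * indicator (f' -` A) x \<partial>lborel)"
      by (intro nn_integral_cong) (auto split: split_indicator)
    also have "\<dots> = emeasure (unif_on {0..1}) (f' -` A)"
      unfolding unif_on_def using P by (subst emeasure_density) auto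
    also have "\<dots> = emeasure (distr (unif_on {0..1}) borel f') A"
      using f' A by (subst emeasure_distr) auto
    finally show "emeasure (distr (lebesgue_on {0..1}) borel f') A = emeasure (distr (unif_on {0..1}) borel f') A" .
  qed simp
  finally show ?thesis .
qed

lemma borel_measurable_snd_real: "snd \<in> borel_measurable (borel :: (real \<times> real) measure)"
  by (intro borel_measurable_continuous_onI continuous_intros)

text \<open>The densities of \<open>S_digraph 0 m\<close> are the moments of the scores, so the
  score distributions converge in moments, hence against continuous functions, to the law of
  \<open>f'\<close>. Applied to hinge functions this carries \<open>tournament_hinge\<close> to the
  limit with vanishing error; the first moment gives the mean 1/2.\<close>

lemma limit_imp_landau:
  fixes f' :: "real \<Rightarrow> real"
  assumes \<Gamma>: "tournament_limit \<Gamma>" and out: "outdegree_distribution \<Gamma> (distr (unif_on {0..1}) borel f')"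
    and f'[measurable]: "f' \<in> borel_measurable borel" and f'01: "\<And>x. f' x \<in> {0..1}"
  shows "landau_condition (unif_on {0..1}) f'"
proof -
  let ?U = "unif_on {0..1::real}"
  obtain G :: "nat \<Rightarrow> nat pair_pre_digraph" where G: "\<And>n. tournament (G n)"
    and card: "filterlim (\<lambda>n. card (pverts (G n))) at_top sequentially"
    and lim: "\<And>F. pair_digraph F \<Longrightarrow> (\<lambda>n. hom_density F (G n)) \<longlonglongrightarrow> \<Gamma> F"
    using \<Gamma> unfolding tournament_limit_def by blast
  obtain \<nu> where \<nu>: "degree_distribution \<Gamma> \<nu>" "distr ?U borel f' = distr \<nu> borel snd"
    using out unfolding outdegree_distribution_def by blast
  have [measurable_cong]: "sets \<nu> = sets borel" using \<nu>(1) by (simp add: degree_distribution_def)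
  have [measurable]: "snd \<in> borel_measurable \<nu>"
    using borel_measurable_snd_real by (simp cong: measurable_cong_sets)
  have dig: "pair_digraph (G n)" for n using G by (simp add: tournament_def)
  have \<Gamma>_eq: "\<Gamma> (S_digraph 0 m) = (\<integral>y. f' y ^ m \<partial>?U)" for m
  proof -
    have "(\<integral>(x, y). x ^ 0 * y ^ m \<partial>\<nu>) = \<Gamma> (S_digraph 0 m)"
      using \<nu>(1) unfolding degree_distribution_def by blast
    then have "\<Gamma> (S_digraph 0 m) = (\<integral>p. snd p ^ m \<partial>\<nu>)" by (simp add: case_prod_unfold)
    also have "\<dots> = (\<integral>y. y ^ m \<partial>distr \<nu> borel snd)"
      by (rule integral_distr[symmetric]) measurable
    also have "\<dots> = (\<integral>y. f' y ^ m \<partial>?U)"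
      unfolding \<nu>(2)[symmetric] by (rule integral_distr) auto
    finally show ?thesis .
  qed
  have moments: "(\<lambda>n. (\<Sum>v\<in>pverts (G n). score_of (G n) v ^ m) / card (pverts (G n)))
      \<longlonglongrightarrow> (\<integral>y. f' y ^ m \<partial>?U)" for m
    using lim[OF pair_digraph_S_digraph[of 0 m]] unfolding hom_density_S_digraph[OF dig] \<Gamma>_eq by simp
  have limit: "(\<lambda>n. (\<Sum>v\<in>pverts (G n). \<phi> (score_of (G n) v)) / card (pverts (G n)))
      \<longlonglongrightarrow> (\<integral>y. \<phi> (f' y) \<partial>?U)" if "continuous_on UNIV \<phi>" for \<phi>
    by (rule unif.moments_imp_expectation_limit[OF _ _ _ moments that])
      (use f'01 score_of_bounds[OF G] in auto)
  have ne: "\<forall>\<^sub>F n in sequentially. pverts (G n) \<noteq> {}"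
    using card[unfolded filterlim_at_top, rule_format, of 1] by eventually_elim auto
  have zero: "(\<lambda>n. 1 / (2 * real (card (pverts (G n))))) \<longlonglongrightarrow> 0"
    using tendsto_mult_right_zero[OF tendsto_inverse_0_at_top[OF filterlim_compose[OF filterlim_real_sequentially card]], of "1 / 2"]
    by (simp add: field_simps)
  have hinge: "(\<integral>y. max 0 (c - f' y) \<partial>?U) \<le> c\<^sup>2 / 2 + 0" for c
  proof (rule tendsto_le[OF sequentially_bot])
    show "(\<lambda>n. c\<^sup>2 / 2 + 1 / (2 * real (card (pverts (G n))))) \<longlonglongrightarrow> c\<^sup>2 / 2 + 0"
      by (intro tendsto_intros zero)
    show "(\<lambda>n. (\<Sum>v\<in>pverts (G n). max 0 (c - score_of (G n) v)) / card (pverts (G n)))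
      \<longlonglongrightarrow> (\<integral>y. max 0 (c - f' y) \<partial>?U)"
      by (rule limit) (intro continuous_intros)
    show "\<forall>\<^sub>F n in sequentially. (\<Sum>v\<in>pverts (G n). max 0 (c - score_of (G n) v)) / card (pverts (G n))
      \<le> c\<^sup>2 / 2 + 1 / (2 * real (card (pverts (G n))))"
      using ne by eventually_elim (use tournament_hinge[OF G] in simp)
  qed
  have "(\<lambda>n. 1 / 2 - 1 / (2 * real (card (pverts (G n))))) \<longlonglongrightarrow> 1 / 2 - 0"
    by (intro tendsto_intros zero)
  moreover have "\<forall>\<^sub>F n in sequentially. 1 / 2 - 1 / (2 * real (card (pverts (G n))))
      = (\<Sum>v\<in>pverts (G n). score_of (G n) v) / card (pverts (G n))"
    using ne by eventually_elim (use tournament_mean_score[OF G] in simp)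
  ultimately have "(\<lambda>n. (\<Sum>v\<in>pverts (G n). score_of (G n) v) / card (pverts (G n))) \<longlonglongrightarrow> 1 / 2 - 0"
    by (rule Lim_transform_eventually)
  then have "(\<integral>y. f' y \<partial>?U) = 1 / 2"
    using moments[of 1] LIMSEQ_unique by fastforce
  moreover have "(unif.prob B)\<^sup>2 / 2 - 0 \<le> (\<integral>y. indicator B y * f' y \<partial>?U)" if "B \<in> sets ?U" for B
    by (rule unif.hinge_imp_lower[OF _ _ hinge that]) (use f'01 in auto)
  ultimately show ?thesis by (simp add: landau_condition_def)
qed

text \<open>Hinge functions and the identity are 1-Lipschitz, so passing to quantile points costs a
  slack of 1/N. The scores then deviate from these points by at most 3/N + 1/N = 4/N in mean square,
  hence by its root in mean absolute value; the other summand 1/N compares the points with the law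
  of \<open>f\<close>.\<close>

lemma (in prob_space) landau_imp_tournament:
  fixes f :: "'a \<Rightarrow> real"
  assumes f[measurable]: "f \<in> borel_measurable M" and f01: "\<And>x. x \<in> space M \<Longrightarrow> f x \<in> {0..1}"
    and L: "landau_condition M f" and N: "0 < N"
  obtains G :: "nat pair_pre_digraph" where "tournament G" "pverts G = {..<N}"
    and "\<And>\<phi> L. \<phi> \<in> borel_measurable borel \<Longrightarrow>
      (\<And>x y. x \<in> {0..1} \<Longrightarrow> y \<in> {0..1} \<Longrightarrow> \<bar>\<phi> x - \<phi> y\<bar> \<le> L * \<bar>x - y\<bar>) \<Longrightarrow>
      \<bar>(\<Sum>v<N. \<phi> (score_of G v)) / N - (\<integral>x. \<phi> (f x) \<partial>M)\<bar> \<le> L * (1 / N + sqrt (4 / N))"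
proof -
  obtain a :: "nat \<Rightarrow> real" where a01: "\<And>v. a v \<in> {0..1}"
    and a: "\<And>\<phi> L. \<phi> \<in> borel_measurable borel \<Longrightarrow>
      (\<And>x y. x \<in> {0..1} \<Longrightarrow> y \<in> {0..1} \<Longrightarrow> \<bar>\<phi> x - \<phi> y\<bar> \<le> L * \<bar>x - y\<bar>) \<Longrightarrow>
      \<bar>(\<Sum>v<N. \<phi> (a v)) / N - (\<integral>x. \<phi> (f x) \<partial>M)\<bar> \<le> L / N"
    using equidistributed_points[OF f f01 N] by blast
  have "(\<Sum>v<N. max 0 (c - a v)) / N \<le> c\<^sup>2 / 2 + 1 / N" for c
  proof -
    have "\<bar>(\<Sum>v<N. max 0 (c - a v)) / N - (\<integral>x. max 0 (c - f x) \<partial>M)\<bar> \<le> 1 / N"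
      by (rule a) auto
    then show ?thesis using landau_imp_hinge[OF f f01 L, of c] by linarith
  qed
  moreover have "(\<Sum>v<N. a v) / N \<le> 1 / 2 + 1 / N"
  proof -
    have "\<bar>(\<Sum>v<N. a v) / N - (\<integral>x. f x \<partial>M)\<bar> \<le> 1 / N" by (rule a) auto
    moreover have "(\<integral>x. f x \<partial>M) = 1 / 2" using L by (simp add: landau_condition_def)
    ultimately show ?thesis by linarith
  qed
  ultimately obtain G where G: "tournament G" "pverts G = {..<N}"
    and sq: "(\<Sum>v<N. (score_of G v - a v)\<^sup>2) / N \<le> 3 * (1 / N) + 1 / N"
    using tournament_near_scores[OF N, of a "1 / N"] a01 by blast
  have sc: "score_of G v \<in> {0..1}" if "v < N" for v
    using score_of_bounds[OF G(1)] G(2) that by simp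
  have "(\<Sum>v<N. \<bar>score_of G v - a v\<bar>) / card {..<N} \<le> sqrt ((\<Sum>v<N. (score_of G v - a v)\<^sup>2) / card {..<N})"
  proof (rule abs_average_le_sqrt)
    show "\<bar>score_of G v - a v\<bar> \<le> 1" if "v \<in> {..<N}" for v
      using sc[of v] a01[of v] that by (auto simp: abs_le_iff)
  qed (use N in auto)
  also have "\<dots> \<le> sqrt (4 / N)" using sq by simp
  finally have dev: "(\<Sum>v<N. \<bar>score_of G v - a v\<bar>) / N \<le> sqrt (4 / N)" by simp
  show thesis
  proof (rule that[OF G])
    fix \<phi> :: "real \<Rightarrow> real" and L :: real
    assume \<phi>: "\<phi> \<in> borel_measurable borel"
      and lip: "\<And>x y. x \<in> {0..1} \<Longrightarrow> y \<in> {0..1} \<Longrightarrow> \<bar>\<phi> x - \<phi> y\<bar> \<le> L * \<bar>x - y\<bar>"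
    have L: "0 \<le> L" using lip[of 0 1] by auto
    have "\<bar>(\<Sum>v<N. \<phi> (score_of G v)) / N - (\<Sum>v<N. \<phi> (a v)) / N\<bar>
        = \<bar>\<Sum>v<N. \<phi> (score_of G v) - \<phi> (a v)\<bar> / N"
      by (simp add: sum_subtractf flip: diff_divide_distrib)
    also have "\<dots> \<le> (\<Sum>v<N. L * \<bar>score_of G v - a v\<bar>) / N"
      by (intro divide_right_mono order_trans[OF sum_abs] sum_mono lip sc a01) auto
    also have "\<dots> = L * ((\<Sum>v<N. \<bar>score_of G v - a v\<bar>) / N)" by (simp add: sum_distrib_left)
    also have "\<dots> \<le> L * sqrt (4 / N)" by (rule mult_left_mono[OF dev L])
    finally show "\<bar>(\<Sum>v<N. \<phi> (score_of G v)) / N - (\<integral>x. \<phi> (f x) \<partial>M)\<bar> \<le> L * (1 / N + sqrt (4 / N))"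
      using a[OF \<phi> lip] by (simp add: distrib_left)
  qed
qed

lemma power_Lipschitz:
  fixes x y :: real
  assumes "x \<in> {0..1}" "y \<in> {0..1}"
  shows "\<bar>x ^ m - y ^ m\<bar> \<le> m * \<bar>x - y\<bar>"
  using norm_power_diff[of x y m] assms by simp

lemma power_product_Lipschitz:
  fixes x y :: real
  assumes x: "x \<in> {0..1}" and y: "y \<in> {0..1}"
  shows "\<bar>(1 - x) ^ m * x ^ n - (1 - y) ^ m * y ^ n\<bar> \<le> (m + n) * \<bar>x - y\<bar>"
proof -
  have "(1 - x) ^ m * x ^ n - (1 - y) ^ m * y ^ n
      = ((1 - x) ^ m - (1 - y) ^ m) * x ^ n + (1 - y) ^ m * (x ^ n - y ^ n)"
    by (simp add: algebra_simps)
  then have "\<bar>(1 - x) ^ m * x ^ n - (1 - y) ^ m * y ^ n\<bar>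
      \<le> \<bar>(1 - x) ^ m - (1 - y) ^ m\<bar> * \<bar>x ^ n\<bar> + \<bar>(1 - y) ^ m\<bar> * \<bar>x ^ n - y ^ n\<bar>"
    by (metis abs_mult abs_triangle_ineq)
  also have "\<dots> \<le> \<bar>(1 - x) ^ m - (1 - y) ^ m\<bar> * 1 + 1 * \<bar>x ^ n - y ^ n\<bar>"
    using x y by (intro add_mono mult_mono) (auto simp: power_le_one power_abs[symmetric])
  also have "\<dots> \<le> m * \<bar>(1 - x) - (1 - y)\<bar> + n * \<bar>x - y\<bar>"
    using x y power_Lipschitz[of "1 - x" "1 - y" m] power_Lipschitz[OF x y, of n] by simp
  finally show ?thesis by (simp add: distrib_right abs_minus_commute)
qed

text \<open>In-neighbours, out-neighbours and \<open>v\<close> itself exhaust the vertices, so the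
  normalised indegree is \<open>1 - score_of G v - 1 / N\<close>. Up to O(m/N) the mixed moments are
  thus expectations of a function of the score alone.\<close>

lemma tournament_degree_moment:
  assumes G: "tournament G" and v: "v \<in> pverts G"
  shows "\<bar>(real (indegree G v) / card (pverts G)) ^ m * score_of G v ^ n
      - (1 - score_of G v) ^ m * score_of G v ^ n\<bar> \<le> m / card (pverts G)"
proof -
  let ?N = "real (card (pverts G))" and ?i = "real (indegree G v) / card (pverts G)"
  have N: "0 < ?N" and sum: "real (indegree G v) + real (outdegree G v) + 1 = ?N"
    using tournament_indegree[OF assms] by linarith+
  have "real (indegree G v) = ?N - real (outdegree G v) - 1" using sum by linarith
  then have i: "?i = 1 - score_of G v - 1 / ?N"
    using N by (simp add: score_of_def diff_divide_distrib)
  have s: "score_of G v \<in> {0..1}" using score_of_bounds[OF assms] by simp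
  have "?i \<in> {0..1}" using N sum by (simp add: divide_le_eq)
  then have "\<bar>?i ^ m - (1 - score_of G v) ^ m\<bar> \<le> m * \<bar>?i - (1 - score_of G v)\<bar>"
    using s by (intro power_Lipschitz) auto
  also have "\<dots> = m / ?N" using i by simp
  finally have *: "\<bar>?i ^ m - (1 - score_of G v) ^ m\<bar> \<le> m / ?N" .
  have "\<bar>?i ^ m * score_of G v ^ n - (1 - score_of G v) ^ m * score_of G v ^ n\<bar>
      = \<bar>?i ^ m - (1 - score_of G v) ^ m\<bar> * score_of G v ^ n"
    using s by (simp add: abs_mult flip: left_diff_distrib)
  also have "\<dots> \<le> \<bar>?i ^ m - (1 - score_of G v) ^ m\<bar> * 1"
    using s by (intro mult_left_mono) (auto simp: power_le_one)
  finally show ?thesis using * by simp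
qed

lemma hom_density_bounds:
  assumes F: "pair_digraph F" and G: "pair_digraph G"
  shows "0 \<le> hom_density F G" "hom_density F G \<le> 1"
proof -
  have fin: "finite (pverts F \<rightarrow>\<^sub>E pverts G)"
    using pair_digraphD(1)[OF F] pair_digraphD(1)[OF G] by (intro finite_PiE) auto
  have "card (digraph_homs F G) \<le> card (pverts F \<rightarrow>\<^sub>E pverts G)"
    by (rule card_mono[OF fin]) (auto simp: digraph_homs_def)
  also have "\<dots> = card (pverts G) ^ card (pverts F)"
    using pair_digraphD(1)[OF F] by (rule card_funcsetE)
  finally have "real (card (digraph_homs F G)) \<le> real (card (pverts G)) ^ card (pverts F)"
    by (metis of_nat_le_iff of_nat_power)
  then show "hom_density F G \<le> 1"
    unfolding hom_density_def by (metis divide_le_eq_1 less_eq_real_def of_nat_0_le_iff zero_le_power)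
  show "0 \<le> hom_density F G" by (simp add: hom_density_def)
qed

section \<open>Extraction of a convergent subsequence and construction of the limit\<close>

lemma countable_pair_digraphs: "countable {F :: nat pair_pre_digraph. pair_digraph F}"
proof (rule countable_image_inj_on)
  show "inj_on (\<lambda>F. (pverts F, parcs F)) {F :: nat pair_pre_digraph. pair_digraph F}"
    by (auto simp: inj_on_def)
  have "(\<lambda>F. (pverts F, parcs F)) ` {F :: nat pair_pre_digraph. pair_digraph F}
      \<subseteq> Collect finite \<times> Collect finite"
    using pair_digraphD(1,2) by auto
  then show "countable ((\<lambda>F. (pverts F, parcs F)) ` {F :: nat pair_pre_digraph. pair_digraph F})"
    by (rule countable_subset) (intro countable_SIGMA countable_Collect_finite)
qed

lemma convergent_density_subsequence:
  fixes G :: "nat \<Rightarrow> 'a pair_pre_digraph"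
  assumes G: "\<And>n. pair_digraph (G n)"
  obtains r :: "nat \<Rightarrow> nat" where "strict_mono r"
    and "\<And>F :: nat pair_pre_digraph. pair_digraph F \<Longrightarrow> convergent (\<lambda>k. hom_density F (G (r k)))"
proof -
  let ?S = "{F :: nat pair_pre_digraph. pair_digraph F}"
  define e where "e = from_nat_into ?S"
  have ne: "?S \<noteq> {}" using pair_digraph_S_digraph by blast
  have e: "pair_digraph (e i)" for i using from_nat_into[OF ne, of i] by (simp add: e_def)
  define P where "P i s = convergent (\<lambda>k. hom_density (e i) (G (s k)))" for i and s :: "nat \<Rightarrow> nat"
  interpret subseqs P
  proof
    fix i and s :: "nat \<Rightarrow> nat"
    have "seq_compact {0..1::real}" using compact_Icc by (simp add: compact_eq_seq_compact_metric)
    then obtain l r where "strict_mono r" "((\<lambda>k. hom_density (e i) (G (s k))) \<circ> r) \<longlonglongrightarrow> l"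
      unfolding seq_compact_def using hom_density_bounds[OF e G] by (metis atLeastAtMost_iff)
    then show "\<exists>r'. strict_mono r' \<and> P i (s \<circ> r')"
      by (auto simp: P_def convergent_def o_def)
  qed
  show thesis
  proof (rule that[OF subseq_diagseq])
    fix F :: "nat pair_pre_digraph" assume "pair_digraph F"
    then obtain i where i: "F = e i"
      using from_nat_into_surj[OF countable_pair_digraphs, of F] by (auto simp: e_def)
    \<comment> \<open>From index \<open>Suc i\<close> on, the diagonal sequence is a subsequence of
      the one chosen for the i-th digraph. Convergence is therefore obtained for a shifted sequence,
      and the shift is dropped afterwards.\<close>
    have "P i (diagseq \<circ> ((+) (Suc i)))"
    proof (rule diagseq_holds)
      fix r s :: "nat \<Rightarrow> nat" and n assume "strict_mono r" "P n s"
      then show "P n (s \<circ> r)"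
        using convergent_subseq_convergent[of "\<lambda>k. hom_density (e n) (G (s k))" r]
        by (simp add: P_def o_def)
    qed
    then have "convergent (\<lambda>k. hom_density F (G (diagseq (k + Suc i))))"
      by (simp add: P_def i o_def add.commute)
    then show "convergent (\<lambda>k. hom_density F (G (diagseq k)))"
      by (subst (asm) convergent_ignore_initial_segment)
  qed
qed

lemma landau_imp_limit:
  fixes f' :: "real \<Rightarrow> real"
  assumes L: "landau_condition (unif_on {0..1}) f'"
    and f'[measurable]: "f' \<in> borel_measurable borel" and f'01: "\<And>x. f' x \<in> {0..1}"
  shows "\<exists>\<Gamma>. tournament_limit \<Gamma> \<and> outdegree_distribution \<Gamma> (distr (unif_on {0..1}) borel f')"
proof -
  let ?U = "unif_on {0..1::real}"
  \<comment> \<open>\<open>Suc N\<close> vertices keep every tournament nonempty. The estimate is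
    quantified over all Lipschitz functions inside, so that one tournament serves all
    moments.\<close>
  have "\<exists>G :: nat pair_pre_digraph. tournament G \<and> pverts G = {..<Suc N} \<and>
      (\<forall>\<phi> L. \<phi> \<in> borel_measurable borel \<longrightarrow>
        (\<forall>x y. x \<in> {0..1} \<longrightarrow> y \<in> {0..1} \<longrightarrow> \<bar>\<phi> x - \<phi> y\<bar> \<le> L * \<bar>x - y\<bar>) \<longrightarrow>
        \<bar>(\<Sum>v<Suc N. \<phi> (score_of G v)) / Suc N - (\<integral>x. \<phi> (f' x) \<partial>?U)\<bar>
          \<le> L * (1 / Suc N + sqrt (4 / Suc N)))" for N
    by (rule unif.landau_imp_tournament[of f' "Suc N"]) (use L f'01 in auto)
  then obtain G :: "nat \<Rightarrow> nat pair_pre_digraph" where G: "\<And>N. tournament (G N)"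
    and V: "\<And>N. pverts (G N) = {..<Suc N}"
    and approx: "\<And>N \<phi> L. \<phi> \<in> borel_measurable borel \<Longrightarrow>
        (\<And>x y. x \<in> {0..1} \<Longrightarrow> y \<in> {0..1} \<Longrightarrow> \<bar>\<phi> x - \<phi> y\<bar> \<le> L * \<bar>x - y\<bar>) \<Longrightarrow>
        \<bar>(\<Sum>v<Suc N. \<phi> (score_of (G N) v)) / Suc N - (\<integral>x. \<phi> (f' x) \<partial>?U)\<bar>
          \<le> L * (1 / Suc N + sqrt (4 / Suc N))"
    by metis
  have dig: "pair_digraph (G N)" for N using G by (simp add: tournament_def)
  obtain r :: "nat \<Rightarrow> nat" where r: "strict_mono r"
    and conv: "\<And>F :: nat pair_pre_digraph. pair_digraph F \<Longrightarrow> convergent (\<lambda>k. hom_density F (G (r k)))"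
    using convergent_density_subsequence[of G, OF dig] by blast
  define \<Gamma> where "\<Gamma> F = lim (\<lambda>k. hom_density F (G (r k)))" for F :: "nat pair_pre_digraph"
  have lim: "(\<lambda>k. hom_density F (G (r k))) \<longlonglongrightarrow> \<Gamma> F" if "pair_digraph F" for F
    using conv[OF that] by (simp add: \<Gamma>_def convergent_LIMSEQ_iff)
  have "tournament_limit \<Gamma>"
    unfolding tournament_limit_def
  proof (intro exI[of _ "\<lambda>k. G (r k)"] conjI allI impI G lim)
    show "filterlim (\<lambda>n. card (pverts (G (r n)))) at_top sequentially"
      unfolding V card_lessThan
      by (intro filterlim_compose[OF filterlim_Suc] filterlim_subseq r)
  qed
  moreover have moment: "\<Gamma> (S_digraph m n) = (\<integral>x. (1 - f' x) ^ m * f' x ^ n \<partial>?U)" for m n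
  proof -
    have est: "\<bar>hom_density (S_digraph m n) (G N) - (\<integral>x. (1 - f' x) ^ m * f' x ^ n \<partial>?U)\<bar>
        \<le> m / Suc N + (m + n) * (1 / Suc N + sqrt (4 / Suc N))" for N
    proof -
      let ?s = "score_of (G N)" and ?i = "\<lambda>v. real (indegree (G N) v) / Suc N"
      have "\<bar>(\<Sum>v<Suc N. (1 - ?s v) ^ m * ?s v ^ n) / Suc N - (\<integral>x. (1 - f' x) ^ m * f' x ^ n \<partial>?U)\<bar>
          \<le> real (m + n) * (1 / Suc N + sqrt (4 / Suc N))"
        by (rule approx) (auto intro: power_product_Lipschitz)
      moreover have "\<bar>hom_density (S_digraph m n) (G N) - (\<Sum>v<Suc N. (1 - ?s v) ^ m * ?s v ^ n) / Suc N\<bar>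
          \<le> m / Suc N"
      proof -
        have "\<bar>hom_density (S_digraph m n) (G N) - (\<Sum>v<Suc N. (1 - ?s v) ^ m * ?s v ^ n) / Suc N\<bar>
            = \<bar>\<Sum>v<Suc N. ?i v ^ m * ?s v ^ n - (1 - ?s v) ^ m * ?s v ^ n\<bar> / Suc N"
          unfolding hom_density_S_digraph[OF dig] V card_lessThan sum_subtractf
          by (simp only: diff_divide_distrib[symmetric] abs_divide abs_of_nat)
        also have "\<dots> \<le> (\<Sum>v<Suc N. m / Suc N) / Suc N"
          using tournament_degree_moment[OF G, of _ N m n] unfolding V card_lessThan
          by (intro divide_right_mono order_trans[OF sum_abs] sum_mono) auto
        also have "\<dots> = m / Suc N" by simp
        finally show ?thesis .
      qed
      ultimately show ?thesis by linarith
    qed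
    have "(\<lambda>N. m / Suc N + (m + n) * (1 / Suc N + sqrt (4 / Suc N))) \<longlonglongrightarrow> 0"
      by real_asymp
    then have "(\<lambda>N. hom_density (S_digraph m n) (G N) - (\<integral>x. (1 - f' x) ^ m * f' x ^ n \<partial>?U)) \<longlonglongrightarrow> 0"
      by (rule Lim_null_comparison[rotated]) (use est in simp)
    then have "(\<lambda>N. hom_density (S_digraph m n) (G N)) \<longlonglongrightarrow> (\<integral>x. (1 - f' x) ^ m * f' x ^ n \<partial>?U)"
      by (simp add: LIM_zero_iff)
    \<comment> \<open>The densities of the digraphs \<open>S_digraph m n\<close> converge along the
      full sequence; passing to a subsequence serves only the remaining digraphs.\<close>
    from LIMSEQ_subseq_LIMSEQ[OF this r]
    have "(\<lambda>k. hom_density (S_digraph m n) (G (r k))) \<longlonglongrightarrow> (\<integral>x. (1 - f' x) ^ m * f' x ^ n \<partial>?U)"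
      by (simp add: o_def)
    then show ?thesis using lim[OF pair_digraph_S_digraph] LIMSEQ_unique by blast
  qed
  \<comment> \<open>The limiting degree distribution is carried by the line x + y = 1, since the
    limits of the normalised indegree and outdegree of a vertex are complementary.\<close>
  define \<nu> where "\<nu> = distr ?U borel (\<lambda>x. (1 - f' x, f' x))"
  have pm[measurable]: "(\<lambda>x. (1 - f' x, f' x)) \<in> borel_measurable ?U" by measurable
  have "outdegree_distribution \<Gamma> (distr ?U borel f')"
    unfolding outdegree_distribution_def
  proof (intro exI[of _ \<nu>] conjI)
    show "distr ?U borel f' = distr \<nu> borel snd"
      unfolding \<nu>_def by (subst distr_distr[OF borel_measurable_snd_real pm]) (simp add: o_def)
    show "degree_distribution \<Gamma> \<nu>"
      unfolding degree_distribution_def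
    proof (intro conjI allI)
      show "prob_space \<nu>" unfolding \<nu>_def by (rule unif.prob_space_distr[OF pm])
      show "sets \<nu> = sets borel" by (simp add: \<nu>_def)
      show "AE p in \<nu>. p \<in> {0..1} \<times> {0..1}"
        unfolding \<nu>_def by (subst AE_distr_iff[OF pm]) (use f'01 in \<open>auto intro!: borel_closed closed_Times\<close>)
      show "(\<integral>(x, y). x ^ m * y ^ n \<partial>\<nu>) = \<Gamma> (S_digraph m n)" for m n
        unfolding \<nu>_def moment
      proof (subst integral_distr[OF pm])
        show "(\<lambda>(x, y). x ^ m * y ^ n) \<in> borel_measurable (borel :: (real \<times> real) measure)"
          unfolding case_prod_unfold by (intro borel_measurable_continuous_onI continuous_intros)
      qed simp
    qed
  qed
  ultimately show ?thesis by blast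
qed

theorem mainTheorem2:
  fixes f :: "real \<Rightarrow> real"
  assumes "f \<in> borel_measurable (lebesgue_on {0..1})"
    and "\<And>x. x \<in> {0..1} \<Longrightarrow> f x \<in> {0..1}"
  shows "((\<exists>\<Gamma>. tournament_limit \<Gamma> \<and>
             outdegree_distribution \<Gamma> (distr (lebesgue_on {0..1}) borel f))
          \<longleftrightarrow> (\<exists>W. tournament_kernel W \<and> has_score_function W f))
       \<and> ((\<exists>W. tournament_kernel W \<and> has_score_function W f) \<longleftrightarrow> condition_I f)"
proof -
  have "{0..1::real} \<in> sets borel" by simp
  \<comment> \<open>The law of \<open>f\<close> and condition I depend on \<open>f\<close> only up
    to null sets, so they can be read off the Borel representative. The score condition is
    pointwise, which is why the original \<open>f\<close> also enters the construction of the
    kernel.\<close>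
  then obtain f' where f': "f' \<in> borel_measurable borel" "\<And>x. f' x \<in> {0..1}"
    and ae: "AE x in unif_on {0..1}. f x = f' x"
    using borel_representative[OF _ assms] by blast
  note law = distr_lebesgue_on_eq[OF assms(1) f'(1) ae]
  have "(\<exists>\<Gamma>. tournament_limit \<Gamma> \<and> outdegree_distribution \<Gamma> (distr (lebesgue_on {0..1}) borel f))
      \<longleftrightarrow> landau_condition (unif_on {0..1}) f'"
    unfolding law using limit_imp_landau landau_imp_limit f' by blast
  moreover have "(\<exists>W. tournament_kernel W \<and> has_score_function W f)
      \<longleftrightarrow> landau_condition (unif_on {0..1}) f'"
    using kernel_with_score_imp_landau[OF _ _ f'(1) ae]
      landau_imp_kernel_with_score[OF _ f' ae assms(2)] by blast
  ultimately show ?thesis using condition_I_iff_landau[OF f'(1) ae] by blast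
qed

end
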